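(* A bipartite graph $G$ is outerplanar if and only if $K_{2,3}$ is not a bipartite minor of $G$.
   Context: All graphs are finite and simple. A graph is outerplanar if it can be embedded in the plane with all vertices on the outer boundary. For a graph $G$ and vertex $v$, $G-v$ is the induced subgraph on $V(G)\setminus\{v\}$. If $G$ is bipartite and $u,v$ are in the same part, the contraction of $u$ with $v$ is the graph on $V(G)\setminus\{u\}$ obtained by identifying $u$ with $v$ and deleting the extra copy of each resulting double edge. A cycle $C$ of $G$ is peripheral if it is induced (no two nonadjacent vertices of $C$ are joined by an edge of $G$) and non-separating (removing the vertices of $C$ from $G$ does not increase the number of connected components). A contraction of $u$ with $v$ in a graph $G_i$ is admissible if $u$ and $v$ have a common neighbor $w$ in $G_i$ such that the path $(u,w,v)$ is part of a peripheral cycle of $G_i$. For a bipartite graph $G$, a graph $H$ is a bipartite minor of $G$ if there is a sequence $G=G_0,G_1,\dots,G_t$ with $G_t$ isomorphic to $H$, where each $G_{i+1}$ is obtained from $G_i$ by deleting a vertex, deleting an edge, or performing an admissible contraction. *)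

theory Defs
  imports "HOL-Analysis.Analysis"
begin

record 'a ugraph =
  verts :: "'a set"
  edges :: "'a set set"

definition simple_graph :: "'a ugraph \<Rightarrow> bool" where
  "simple_graph G \<longleftrightarrow> finite (verts G) \<and>
     (\<forall>e\<in>edges G. \<exists>u\<in>verts G. \<exists>v\<in>verts G. u \<noteq> v \<and> e = {u, v})"

definition bipartition :: "'a ugraph \<Rightarrow> 'a set \<Rightarrow> 'a set \<Rightarrow> bool" where
  "bipartition G X Y \<longleftrightarrow> X \<union> Y = verts G \<and> X \<inter> Y = {} \<and>
     (\<forall>e\<in>edges G. \<exists>x\<in>X. \<exists>y\<in>Y. e = {x, y})"

definition bipartite :: "'a ugraph \<Rightarrow> bool" where
  "bipartite G \<longleftrightarrow> (\<exists>X Y. bipartition G X Y)"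

definition isomorphic :: "'a ugraph \<Rightarrow> 'b ugraph \<Rightarrow> bool" where
  "isomorphic G H \<longleftrightarrow>
     (\<exists>f. bij_betw f (verts G) (verts H) \<and>
          (\<forall>u\<in>verts G. \<forall>v\<in>verts G. {u, v} \<in> edges G \<longleftrightarrow> {f u, f v} \<in> edges H))"

definition complete_bipartite :: "nat \<Rightarrow> nat \<Rightarrow> (nat + nat) ugraph" where
  "complete_bipartite m n =
     \<lparr>verts = Inl ` {..<m} \<union> Inr ` {..<n},
      edges = {{Inl i, Inr j} | i j. i < m \<and> j < n}\<rparr>"

definition graph_components :: "'a ugraph \<Rightarrow> 'a set set" where
  "graph_components G =
     verts G // {(x, y). x \<in> verts G \<and> y \<in> verts G \<and> (x, y) \<in> {(a, b). {a, b} \<in> edges G}\<^sup>*}"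

definition delete_verts :: "'a ugraph \<Rightarrow> 'a set \<Rightarrow> 'a ugraph" where
  "delete_verts G S = \<lparr>verts = verts G - S, edges = {e \<in> edges G. e \<inter> S = {}}\<rparr>"

definition delete_edge :: "'a ugraph \<Rightarrow> 'a set \<Rightarrow> 'a ugraph" where
  "delete_edge G e = \<lparr>verts = verts G, edges = edges G - {e}\<rparr>"

text \<open>The vertex \<open>u\<close> is identified with \<open>v\<close>; since edges form a set of vertex pairs, double edges
  collapse automatically. It is only used for \<open>u\<close>, \<open>v\<close> in the same part of a bipartite graph,
  so that no loop arises.\<close>

definition contract :: "'a ugraph \<Rightarrow> 'a \<Rightarrow> 'a \<Rightarrow> 'a ugraph" where
  "contract G u v =
     \<lparr>verts = verts G - {u},
      edges = {e \<in> edges G. u \<notin> e} \<union> {{v, x} | x. {u, x} \<in> edges G}\<rparr>"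

text \<open>Cycles are given by the cyclically ordered list of their vertices.\<close>

definition cycle_edges :: "'a list \<Rightarrow> 'a set set" where
  "cycle_edges c = {{c ! i, c ! (Suc i mod length c)} | i. i < length c}"

definition is_cycle :: "'a ugraph \<Rightarrow> 'a list \<Rightarrow> bool" where
  "is_cycle G c \<longleftrightarrow> length c \<ge> 3 \<and> distinct c \<and> set c \<subseteq> verts G \<and> cycle_edges c \<subseteq> edges G"

definition induced_cycle :: "'a ugraph \<Rightarrow> 'a list \<Rightarrow> bool" where
  "induced_cycle G c \<longleftrightarrow> is_cycle G c \<and>
     (\<forall>x\<in>set c. \<forall>y\<in>set c. {x, y} \<notin> cycle_edges c \<longrightarrow> {x, y} \<notin> edges G)"

definition non_separating :: "'a ugraph \<Rightarrow> 'a list \<Rightarrow> bool" where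
  "non_separating G c \<longleftrightarrow>
     card (graph_components (delete_verts G (set c))) \<le> card (graph_components G)"

definition peripheral_cycle :: "'a ugraph \<Rightarrow> 'a list \<Rightarrow> bool" where
  "peripheral_cycle G c \<longleftrightarrow> induced_cycle G c \<and> non_separating G c"

definition admissible :: "'a ugraph \<Rightarrow> 'a \<Rightarrow> 'a \<Rightarrow> bool" where
  "admissible G u v \<longleftrightarrow> u \<noteq> v \<and>
     (\<exists>X Y. bipartition G X Y \<and> u \<in> X \<and> v \<in> X) \<and>
     (\<exists>w c. {u, w} \<in> edges G \<and> {w, v} \<in> edges G \<and>
            peripheral_cycle G c \<and> {u, w} \<in> cycle_edges c \<and> {w, v} \<in> cycle_edges c)"

inductive bipartite_minor_step :: "'a ugraph \<Rightarrow> 'a ugraph \<Rightarrow> bool" where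
  del_vertex: "v \<in> verts G \<Longrightarrow> bipartite_minor_step G (delete_verts G {v})"
| del_edge: "e \<in> edges G \<Longrightarrow> bipartite_minor_step G (delete_edge G e)"
| contraction: "admissible G u v \<Longrightarrow> bipartite_minor_step G (contract G u v)"

definition bipartite_minor :: "'b ugraph \<Rightarrow> 'a ugraph \<Rightarrow> bool" where
  "bipartite_minor H G \<longleftrightarrow> (\<exists>G'. bipartite_minor_step\<^sup>*\<^sup>* G G' \<and> isomorphic G' H)"

text \<open>A plane embedding places the vertices at distinct points and draws each edge as a
  simple arc joining its ends, which meets the vertex set only in its ends and every other edge only
  in common ends.\<close>

definition plane_embedding ::
  "'a ugraph \<Rightarrow> ('a \<Rightarrow> complex) \<Rightarrow> ('a set \<Rightarrow> real \<Rightarrow> complex) \<Rightarrow> bool" where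
  "plane_embedding G p \<gamma> \<longleftrightarrow>
     inj_on p (verts G) \<and>
     (\<forall>e\<in>edges G. arc (\<gamma> e) \<and> {pathstart (\<gamma> e), pathfinish (\<gamma> e)} = p ` e \<and>
                  path_image (\<gamma> e) \<inter> p ` verts G = p ` e) \<and>
     (\<forall>e\<in>edges G. \<forall>e'\<in>edges G. e \<noteq> e' \<longrightarrow>
        path_image (\<gamma> e) \<inter> path_image (\<gamma> e') \<subseteq> p ` (e \<inter> e'))"

definition drawing ::
  "'a ugraph \<Rightarrow> ('a \<Rightarrow> complex) \<Rightarrow> ('a set \<Rightarrow> real \<Rightarrow> complex) \<Rightarrow> complex set" where
  "drawing G p \<gamma> = p ` verts G \<union> (\<Union>e\<in>edges G. path_image (\<gamma> e))"

text \<open>For a compact set in the plane, \<^const>\<open>outside\<close> is the unbounded component of the complement,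
  i.e. the outer face of the drawing.\<close>

definition outerplanar :: "'a ugraph \<Rightarrow> bool" where
  "outerplanar G \<longleftrightarrow>
     (\<exists>p \<gamma>. plane_embedding G p \<gamma> \<and> p ` verts G \<subseteq> frontier (outside (drawing G p \<gamma>)))"

end

(* Both sides are compared with the existence of a K_{2,3} minor in the ordinary sense, given by five
   disjoint connected branch sets. For bipartite graphs this subsumes K_4 minors: a K_4 model without
   a K_{2,3} minor shrinks to four mutually adjacent vertices, which contain a triangle.

   Contracting u with v along an induced cycle u, w, v, ... makes v a cut vertex that separates w from the
   rest of the cycle (otherwise a K_{2,3} minor is already visible), so a model in the contracted
   graph lives on one side, and the other side can be used to reconnect u and v. Conversely,
   a K_{2,3} model contains a theta graph, whose paths shrink by admissible contractions.

   If there is no K_{2,3} minor, then, up to gluing along separations of order at most one, a longest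
   cycle is Hamiltonian and has no crossing chords; placing its vertices on a parabola in cyclic order
   and drawing the edges as chords gives an outerplanar embedding. Finally, one arc of a theta curve in the
   plane lies inside the closed curve formed by the other two, so that in a drawing of a K_{2,3}
   minor some vertices are not on the outer face. *)

theory Submission
  imports Defs "HOL-Complex_Analysis.Winding_Numbers"
begin

section \<open>Connected vertex sets and minor models\<close>

text \<open>The obstacle is that \<open>contract\<close> identifies two nonadjacent vertices. This
  is not an edge contraction and can leave the class of ordinary minors: a hexagon becomes a square
  with a pendant edge. So it has to be shown that no K_{2,3} minor is created. Inducedness of the
  cycle prevents it: \<open>w\<close> has no neighbour among the other vertices of the cycle, so a
  connection from \<open>w\<close> to them that avoids \<open>u\<close> and \<open>v\<close>
  supplies a third branch set next to \<open>u\<close> and \<open>v\<close>.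

  Models refer to an edge set alone and consist of arbitrary connected sets, which can be merged,
  shrunk and replaced freely. Rigid objects (theta graphs, arcs) are extracted only at the end,
  after the two sets that touch three others have been reduced to single vertices.

  In the converse direction the contracted graph is not claimed to be a theta graph again. Only
  \<open>has_K23\<close> has to survive; a new theta graph is then extracted from a graph with fewer
  vertices. The process can stop only at K_{2,3}, because the three paths of a bipartite theta graph
  have lengths of equal parity.\<close>

definition adj_on :: "'a set set \<Rightarrow> 'a set \<Rightarrow> ('a \<times> 'a) set" where
  "adj_on E S = {(x, y). x \<in> S \<and> y \<in> S \<and> {x, y} \<in> E}"

definition conn :: "'a set set \<Rightarrow> 'a set \<Rightarrow> bool" where
  "conn E S \<longleftrightarrow> (\<forall>x\<in>S. \<forall>y\<in>S. (x, y) \<in> (adj_on E S)\<^sup>*)"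

definition touch :: "'a set set \<Rightarrow> 'a set \<Rightarrow> 'a set \<Rightarrow> bool" where
  "touch E S T \<longleftrightarrow> (\<exists>x\<in>S. \<exists>y\<in>T. {x, y} \<in> E)"

definition component_in :: "'a set set \<Rightarrow> 'a set \<Rightarrow> 'a \<Rightarrow> 'a set" where
  "component_in E S x = {y. (x, y) \<in> (adj_on E S)\<^sup>*}"

lemma adj_on_rtrancl_sym: "(x, y) \<in> (adj_on E S)\<^sup>* \<Longrightarrow> (y, x) \<in> (adj_on E S)\<^sup>*"
proof -
  have "sym (adj_on E S)"
    by (auto simp: sym_def adj_on_def insert_commute)
  then show "(x, y) \<in> (adj_on E S)\<^sup>* \<Longrightarrow> (y, x) \<in> (adj_on E S)\<^sup>*"
    by (meson sym_rtrancl symD)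
qed

lemma adj_on_rtrancl_mono: "S \<subseteq> T \<Longrightarrow> E \<subseteq> F \<Longrightarrow> (x, y) \<in> (adj_on E S)\<^sup>* \<Longrightarrow> (x, y) \<in> (adj_on F T)\<^sup>*"
  by (rule subsetD[OF rtrancl_mono]) (auto simp: adj_on_def)

lemma adj_on_rtrancl_in: "(x, y) \<in> (adj_on E S)\<^sup>* \<Longrightarrow> x \<in> S \<Longrightarrow> y \<in> S"
  by (erule rtrancl_induct) (auto simp: adj_on_def)

lemma touch_sym: "touch E S T \<longleftrightarrow> touch E T S"
  unfolding touch_def by (metis insert_commute)

lemma conn_empty [simp]: "conn E {}"
  by (simp add: conn_def)

lemma conn_singleton [simp]: "conn E {x}"
  by (simp add: conn_def)

lemma connI_root:
  assumes "\<And>x. x \<in> S \<Longrightarrow> (r, x) \<in> (adj_on E S)\<^sup>*"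
  shows "conn E S"
  unfolding conn_def
  by (meson adj_on_rtrancl_sym assms rtrancl_trans)

lemma conn_Un_overlap:
  assumes "conn E S" "conn E T" "S \<inter> T \<noteq> {}"
  shows "conn E (S \<union> T)"
proof -
  obtain r where r: "r \<in> S" "r \<in> T" using assms by blast
  show ?thesis
  proof (rule connI_root[of _ r])
    fix x assume "x \<in> S \<union> T"
    then have "(r, x) \<in> (adj_on E S)\<^sup>* \<or> (r, x) \<in> (adj_on E T)\<^sup>*"
      using assms r by (auto simp: conn_def)
    then show "(r, x) \<in> (adj_on E (S \<union> T))\<^sup>*"
      using adj_on_rtrancl_mono[of S "S \<union> T" E E] adj_on_rtrancl_mono[of T "S \<union> T" E E] by auto
  qed
qed

lemma conn_doubleton: "{x, y} \<in> E \<Longrightarrow> conn E {x, y}"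
  by (rule connI_root[of _ x]) (auto simp: adj_on_def)

lemma conn_Un:
  assumes "conn E S" "conn E T" "touch E S T"
  shows "conn E (S \<union> T)"
proof -
  obtain x y where xy: "x \<in> S" "y \<in> T" "{x, y} \<in> E"
    using assms by (auto simp: touch_def)
  have "conn E (S \<union> {x, y})"
    using conn_Un_overlap[OF assms(1) conn_doubleton[OF xy(3)]] xy by auto
  then have "conn E ((S \<union> {x, y}) \<union> T)"
    using xy by (intro conn_Un_overlap[OF _ assms(2)]) auto
  moreover have "(S \<union> {x, y}) \<union> T = S \<union> T" using xy by auto
  ultimately show ?thesis by simp
qed

lemma conn_insert: "conn E S \<Longrightarrow> touch E {x} S \<Longrightarrow> conn E (insert x S)"
  using conn_Un[of E "{x}" S] by simp

lemma conn_cut: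
  assumes "conn E S" "x \<in> S" "x \<in> A" "y \<in> S" "y \<notin> A"
  obtains p q where "p \<in> S" "p \<in> A" "q \<in> S" "q \<notin> A" "{p, q} \<in> E"
proof -
  have "(x, y) \<in> (adj_on E S)\<^sup>*" using assms by (simp add: conn_def)
  then have "y \<in> A \<or> (\<exists>p q. p \<in> S \<and> p \<in> A \<and> q \<in> S \<and> q \<notin> A \<and> {p, q} \<in> E)"
    using assms(3) by (induction rule: rtrancl_induct) (auto simp: adj_on_def)
  then show ?thesis using assms(5) that by blast
qed

lemma conn_edges_cong:
  assumes "conn E S" "\<And>x y. x \<in> S \<Longrightarrow> y \<in> S \<Longrightarrow> {x, y} \<in> E \<Longrightarrow> {x, y} \<in> F"
  shows "conn F S"
proof -
  have "adj_on E S \<subseteq> adj_on F S" using assms(2) by (auto simp: adj_on_def)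
  then show ?thesis using assms(1) rtrancl_mono unfolding conn_def by blast
qed

lemma component_in_self: "x \<in> component_in E S x"
  by (simp add: component_in_def)

lemma component_in_subset: "x \<in> S \<Longrightarrow> component_in E S x \<subseteq> S"
  by (auto simp: component_in_def dest: adj_on_rtrancl_in)

lemma component_in_closed:
  assumes "y \<in> component_in E S x" "y \<in> S" "z \<in> S" "{y, z} \<in> E"
  shows "z \<in> component_in E S x"
proof -
  have "(y, z) \<in> adj_on E S" using assms by (simp add: adj_on_def)
  then show ?thesis using assms(1) by (auto simp: component_in_def)
qed

lemma conn_component_in: "conn E (component_in E S x)"
proof (rule connI_root[of _ x])
  fix y assume "y \<in> component_in E S x"
  then have "(x, y) \<in> (adj_on E S)\<^sup>*" by (simp add: component_in_def)
  then show "(x, y) \<in> (adj_on E (component_in E S x))\<^sup>*"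
  proof (induction rule: rtrancl_induct)
    case base then show ?case by simp
  next
    case (step y z)
    then have "(y, z) \<in> adj_on E (component_in E S x)"
      by (auto simp: component_in_def adj_on_def intro: rtrancl_into_rtrancl)
    then show ?case using step by (meson rtrancl_into_rtrancl)
  qed
qed

text \<open>A proper nonempty connected subset of maximum size misses just one vertex, since adding
  the far end of an edge that leaves it would otherwise give a larger one. All shrinking of branch
  sets rests on this split into a vertex and a connected rest.\<close>

lemma conn_noncut_vertex:
  assumes "finite S" "conn E S" "card S \<ge> 2"
  obtains x where "x \<in> S" "conn E (S - {x})" "S - {x} \<noteq> {}" "touch E {x} (S - {x})"
proof -
  define P where "P T \<longleftrightarrow> T \<subseteq> S \<and> T \<noteq> S \<and> T \<noteq> {} \<and> conn E T" for T
  obtain s where s: "s \<in> S" using assms(3) by fastforce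
  have "{s} \<noteq> S" using assms(3) by auto
  then have "P {s}" using s by (auto simp: P_def)
  moreover have "\<forall>T. P T \<longrightarrow> card T < Suc (card S)"
    using assms(1) by (auto simp: P_def less_Suc_eq_le card_mono)
  ultimately obtain T where T: "P T" and max: "\<And>U. P U \<Longrightarrow> card U \<le> card T"
    using ex_has_greatest_nat[of P "{s}" card "Suc (card S)"] by (meson less_imp_le_nat)
  obtain t r where tr: "t \<in> T" "t \<in> S" "r \<in> S" "r \<notin> T" using T by (auto simp: P_def)
  obtain p x where px: "p \<in> T" "x \<in> S" "x \<notin> T" "{p, x} \<in> E"
    using conn_cut[OF assms(2) tr(2,1,3,4)] by blast
  have tch: "touch E {x} T" using px by (auto simp: touch_def insert_commute)
  have "insert x T = S"
  proof (rule ccontr)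
    assume "insert x T \<noteq> S"
    then have "P (insert x T)"
      using T px conn_insert[OF _ tch] by (auto simp: P_def)
    then have "card (insert x T) \<le> card T" by (rule max)
    moreover have "finite T" using T assms(1) finite_subset by (auto simp: P_def)
    ultimately show False using px by simp
  qed
  then have "S - {x} = T" using px by auto
  then show ?thesis using that[of x] T px tch by (auto simp: P_def)
qed

section \<open>Paths as lists of vertices\<close>

definition path_edges :: "'a list \<Rightarrow> 'a set set" where
  "path_edges xs = {{xs ! i, xs ! Suc i} | i. Suc i < length xs}"

lemma path_edges_Nil [simp]: "path_edges [] = {}"
  and path_edges_single [simp]: "path_edges [x] = {}"
  by (auto simp: path_edges_def)

lemma path_edges_Cons2 [simp]: "path_edges (x # y # xs) = insert {x, y} (path_edges (y # xs))"
proof -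
  have "{{(x # y # xs) ! i, (x # y # xs) ! Suc i} | i. Suc i < length (x # y # xs)} =
    insert {x, y} {{(y # xs) ! i, (y # xs) ! Suc i} | i. Suc i < length (y # xs)}" (is "?L = ?R")
  proof
    show "?L \<subseteq> ?R"
    proof
      fix e assume "e \<in> ?L"
      then obtain i where i: "e = {(x # y # xs) ! i, (x # y # xs) ! Suc i}" "Suc i < length (x # y # xs)" by auto
      then show "e \<in> ?R" by (cases i) auto
    qed
    show "?R \<subseteq> ?L"
    proof
      fix e assume "e \<in> ?R"
      then consider "e = {x, y}" | i where "e = {(y # xs) ! i, (y # xs) ! Suc i}" "Suc i < length (y # xs)" by auto
      then show "e \<in> ?L"
      proof cases
        case 1 then show ?thesis by (intro CollectI exI[of _ 0]) auto
      next
        case 2 then show ?thesis by (intro CollectI exI[of _ "Suc i"]) auto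
      qed
    qed
  qed
  then show ?thesis by (simp add: path_edges_def)
qed

lemma path_edges_Cons: "xs \<noteq> [] \<Longrightarrow> path_edges (x # xs) = insert {x, hd xs} (path_edges xs)"
  by (cases xs) auto

lemma path_edges_append:
  "xs \<noteq> [] \<Longrightarrow> ys \<noteq> [] \<Longrightarrow>
   path_edges (xs @ ys) = insert {last xs, hd ys} (path_edges xs \<union> path_edges ys)"
proof (induction xs)
  case (Cons x xs)
  then show ?case by (cases "xs = []") (auto simp: path_edges_Cons)
qed simp

lemma path_edges_append_single: "xs \<noteq> [] \<Longrightarrow> path_edges (xs @ [y]) = insert {last xs, y} (path_edges xs)"
  by (simp add: path_edges_append)

lemma path_edges_rev [simp]: "path_edges (rev xs) = path_edges xs"
proof (induction xs)
  case (Cons x xs)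
  then show ?case
    by (cases "xs = []") (auto simp: path_edges_append_single path_edges_Cons last_rev insert_commute)
qed simp

lemma path_edges_subset: "e \<in> path_edges xs \<Longrightarrow> e \<subseteq> set xs"
  by (auto simp: path_edges_def)

text \<open>Trades the modular index for an explicit repetition of the first vertex, so that the
  rules for \<open>path_edges\<close> and \<open>@\<close> apply to cycles.\<close>

lemma cycle_edges_eq: "c \<noteq> [] \<Longrightarrow> cycle_edges c = path_edges (c @ [hd c])"
proof -
  assume c: "c \<noteq> []"
  have "{c ! i, c ! (Suc i mod length c)} = {(c @ [hd c]) ! i, (c @ [hd c]) ! Suc i}" if "i < length c" for i
    using that c by (cases "Suc i = length c") (auto simp: nth_append hd_conv_nth)
  then show ?thesis unfolding cycle_edges_def path_edges_def by fastforce
qed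

lemma conn_path:
  assumes "path_edges xs \<subseteq> E"
  shows "conn E (set xs)"
  using assms
proof (induction xs)
  case (Cons x xs)
  show ?case
  proof (cases "xs = []")
    case False
    then have "conn E (set xs)" "{x, hd xs} \<in> E" using Cons by (auto simp: path_edges_Cons)
    then have "conn E (insert x (set xs))"
      using hd_in_set[OF False] by (intro conn_insert) (auto simp: touch_def)
    then show ?thesis by simp
  qed simp
qed simp

lemma conn_obtain_path:
  assumes "conn E S" "x \<in> S" "y \<in> S"
  obtains xs where "xs \<noteq> []" "hd xs = x" "last xs = y" "distinct xs" "set xs \<subseteq> S" "path_edges xs \<subseteq> E"
proof -
  have "(x, y) \<in> (adj_on E S)\<^sup>*" using assms by (simp add: conn_def)
  then have "\<exists>xs. xs \<noteq> [] \<and> hd xs = x \<and> last xs = y \<and> distinct xs \<and> set xs \<subseteq> S \<and> path_edges xs \<subseteq> E"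
  proof (induction rule: rtrancl_induct)
    case base
    then show ?case using assms(2) by (intro exI[of _ "[x]"]) auto
  next
    case (step y z)
    then obtain xs where xs: "xs \<noteq> []" "hd xs = x" "last xs = y" "distinct xs" "set xs \<subseteq> S" "path_edges xs \<subseteq> E"
      by blast
    have z: "z \<in> S" "{y, z} \<in> E" using step by (auto simp: adj_on_def)
    \<comment> \<open>If \<open>z\<close> already lies on the path, cutting the path at
      \<open>z\<close> keeps it simple.\<close>
    show ?case
    proof (cases "z \<in> set xs")
      case True
      then obtain ys zs where yz: "xs = ys @ z # zs" by (meson split_list)
      have "path_edges (ys @ [z]) \<subseteq> path_edges xs"
        unfolding yz by (cases "ys = []"; cases zs) (auto simp: path_edges_append)
      then show ?thesis using xs yz
        by (intro exI[of _ "ys @ [z]"]) (auto simp: hd_append split: if_splits)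
    next
      case False
      then show ?thesis using xs z
        by (intro exI[of _ "xs @ [z]"]) (auto simp: path_edges_append_single)
    qed
  qed
  then show ?thesis using that by blast
qed

section \<open>Minor models of K_4 and K_{2,3}\<close>

definition branch_sets :: "'a set set \<Rightarrow> 'a set list \<Rightarrow> bool" where
  "branch_sets E Ss \<longleftrightarrow> (\<forall>S\<in>set Ss. conn E S \<and> S \<noteq> {}) \<and> sorted_wrt (\<lambda>S T. S \<inter> T = {}) Ss"

definition K4_model :: "'a set set \<Rightarrow> 'a set \<Rightarrow> 'a set \<Rightarrow> 'a set \<Rightarrow> 'a set \<Rightarrow> bool" where
  "K4_model E A B C D \<longleftrightarrow> branch_sets E [A, B, C, D] \<and>
     touch E A B \<and> touch E A C \<and> touch E A D \<and> touch E B C \<and> touch E B D \<and> touch E C D"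

definition K23_model :: "'a set set \<Rightarrow> 'a set \<Rightarrow> 'a set \<Rightarrow> 'a set \<Rightarrow> 'a set \<Rightarrow> 'a set \<Rightarrow> bool" where
  "K23_model E A B K L M \<longleftrightarrow> branch_sets E [A, B, K, L, M] \<and>
     touch E A K \<and> touch E A L \<and> touch E A M \<and> touch E B K \<and> touch E B L \<and> touch E B M"

definition has_K23 :: "'a set set \<Rightarrow> bool" where
  "has_K23 E \<longleftrightarrow> (\<exists>A B K L M. K23_model E A B K L M)"

lemma has_K23I: "K23_model E A B K L M \<Longrightarrow> has_K23 E"
  unfolding has_K23_def by blast

lemma K23_modelI:
  assumes "conn E A" "conn E B" "conn E K" "conn E L" "conn E M"
    "A \<noteq> {}" "B \<noteq> {}" "K \<noteq> {}" "L \<noteq> {}" "M \<noteq> {}"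
    "A \<inter> B = {}" "A \<inter> K = {}" "A \<inter> L = {}" "A \<inter> M = {}" "B \<inter> K = {}" "B \<inter> L = {}" "B \<inter> M = {}"
    "K \<inter> L = {}" "K \<inter> M = {}" "L \<inter> M = {}"
    "touch E A K" "touch E A L" "touch E A M" "touch E B K" "touch E B L" "touch E B M"
  shows "K23_model E A B K L M"
  using assms unfolding K23_model_def branch_sets_def by simp

lemma K23_model_swap: "K23_model E A B K L M \<Longrightarrow> K23_model E B A K L M"
  and K23_model_perm1: "K23_model E A B K L M \<Longrightarrow> K23_model E A B L K M"
  and K23_model_perm2: "K23_model E A B K L M \<Longrightarrow> K23_model E A B K M L"
  unfolding K23_model_def branch_sets_def by auto

lemma K4_model_perm1: "K4_model E A B C D \<Longrightarrow> K4_model E B A C D"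
  and K4_model_perm2: "K4_model E A B C D \<Longrightarrow> K4_model E A C B D"
  and K4_model_perm3: "K4_model E A B C D \<Longrightarrow> K4_model E A B D C"
  unfolding K4_model_def branch_sets_def using touch_sym[of E] by auto

lemma touch_Un1: "touch E (S \<union> T) U \<longleftrightarrow> touch E S U \<or> touch E T U"
  and touch_Un2: "touch E U (S \<union> T) \<longleftrightarrow> touch E U S \<or> touch E U T"
  unfolding touch_def by auto

text \<open>If one of \<open>x\<close> and \<open>A - {x}\<close> touches one of \<open>B\<close>, \<open>C\<close>, \<open>D\<close>, say \<open>Z\<close>, while the other one touches
  the remaining two, then that other one and \<open>Z\<close> form the side of size two of a \<open>K23\<close> model.\<close>

lemma K4_split_vertex:
  assumes m: "K4_model E A B C D" and x: "x \<in> A" "conn E (A - {x})" "A - {x} \<noteq> {}" "touch E {x} (A - {x})"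
  shows "has_K23 E \<or> K4_model E {x} B C D \<or> K4_model E (A - {x}) B C D"
proof -
  let ?A = "A - {x}"
  have A: "A = {x} \<union> ?A" using x by auto
  have t: "touch E {x} B \<or> touch E ?A B" "touch E {x} C \<or> touch E ?A C" "touch E {x} D \<or> touch E ?A D"
    using m touch_Un1[of E "{x}" ?A] A unfolding K4_model_def by metis+
  have tx: "touch E ?A {x}" using x(4) touch_sym by metis
  note unf = K4_model_def K23_model_def branch_sets_def
  have one: "K23_model E ?A Z {x} Y U" if "touch E {x} Z" "touch E ?A Y" "touch E ?A U"
    "K4_model E A Z Y U" for Z Y U
    using that x tx touch_sym[of E] unfolding unf by auto
  have two: "K23_model E {x} Z ?A Y U" if "touch E ?A Z" "touch E {x} Y" "touch E {x} U"
    "K4_model E A Z Y U" for Z Y U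
    using that x tx touch_sym[of E] unfolding unf by auto
  have mm: "K4_model E A C B D" "K4_model E A D B C"
    using m K4_model_perm2 K4_model_perm3 by metis+
  \<comment> \<open>If \<open>x\<close> touches all three sets, one contact of the rest gives
    \<open>two\<close>, and without any contact \<open>{x}\<close> replaces \<open>A\<close>. If
    \<open>x\<close> touches exactly two of them, the rest touches the third (\<open>two\<close>);
    if exactly one, the rest touches the other two (\<open>one\<close>); if none, the rest replaces
    \<open>A\<close>.\<close>
  show ?thesis
  proof (cases "touch E {x} B \<and> touch E {x} C \<and> touch E {x} D")
    case True
    show ?thesis
    proof (cases "touch E ?A B \<or> touch E ?A C \<or> touch E ?A D")
      case False
      have "K4_model E {x} B C D" using True m x unfolding unf by auto
      then show ?thesis by simp
    qed (use True two m mm has_K23I in metis)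
  next
    case False
    show ?thesis
    proof (cases "touch E {x} B \<or> touch E {x} C \<or> touch E {x} D")
      case nx: False
      have "K4_model E ?A B C D" using nx t m x unfolding unf by auto
      then show ?thesis by simp
    qed (use False t one two m mm has_K23I in metis)
  qed
qed

text \<open>As long as some branch set has two vertices, splitting off a non-cut vertex either gives
  a K_{2,3} model or a K_4 model of smaller total size. In a bipartite graph the second outcome is
  absurd, because it contains a triangle.\<close>

lemma K4_model_imp_K23_or_singletons:
  assumes "K4_model E A B C D" "finite A" "finite B" "finite C" "finite D"
  shows "has_K23 E \<or> (\<exists>a b c d. K4_model E {a} {b} {c} {d})"
  using assms
proof (induction "card A + card B + card C + card D" arbitrary: A B C D rule: less_induct)
  case less
  have step: "has_K23 E \<or> (\<exists>a b c d. K4_model E {a} {b} {c} {d})"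
    if "card S \<ge> 2" "K4_model E S U V W" "finite S" "finite U" "finite V" "finite W"
      "card S + card U + card V + card W = card A + card B + card C + card D" for S U V W
  proof -
    have "conn E S" using that by (simp add: K4_model_def branch_sets_def)
    from conn_noncut_vertex[OF \<open>finite S\<close> this \<open>card S \<ge> 2\<close>]
    obtain x where x: "x \<in> S" "conn E (S - {x})" "S - {x} \<noteq> {}" "touch E {x} (S - {x})"
      by blast
    have "card {x} < card S" "card (S - {x}) < card S"
      using that(1) card_Diff1_less[OF \<open>finite S\<close> x(1)] by simp_all
    then have "card {x} + card U + card V + card W < card A + card B + card C + card D"
       "card (S - {x}) + card U + card V + card W < card A + card B + card C + card D"
      using that by linarith+
    then show ?thesis
      using K4_split_vertex[OF that(2) x] less.hyps[of "{x}" U V W] less.hyps[of "S - {x}" U V W] that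
      by auto
  qed
  show ?case
  proof (cases "card A \<ge> 2 \<or> card B \<ge> 2 \<or> card C \<ge> 2 \<or> card D \<ge> 2")
    case True
    have "K4_model E B A C D" "K4_model E C A B D" "K4_model E D A B C"
      using less(2) K4_model_perm1 K4_model_perm2 K4_model_perm3 by metis+
    with True show ?thesis
      using step[OF _ less(2)] step[of B A C D] step[of C A B D] step[of D A B C] less(3-6)
      by (elim disjE) (simp_all add: add_ac)
  next
    case False
    have "A \<noteq> {}" "B \<noteq> {}" "C \<noteq> {}" "D \<noteq> {}"
      using less(2) by (auto simp: K4_model_def branch_sets_def)
    then have "card A = 1" "card B = 1" "card C = 1" "card D = 1"
      using False less.prems by (metis One_nat_def card_gt_0_iff Suc_leI le_antisym not_less_eq_eq numeral_2_eq_2)+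
    then show ?thesis using less.prems(1) by (metis card_1_singletonE)
  qed
qed

text \<open>This is the fact that a minor of maximum degree three is also a topological minor, for
  the side of degree three. When \<open>A\<close> is split into a non-cut vertex and the rest, one
  of the two parts touches at least two of \<open>K\<close>, \<open>L\<close>, \<open>M\<close> by
  pigeonhole. If it misses the third set, that set absorbs the other part and thereby gains the
  contact.\<close>

lemma K23_model_shrink_left:
  assumes "K23_model E A B K L M" "finite A"
  shows "\<exists>a K' L' M'. K23_model E {a} B K' L' M'"
  using assms
proof (induction "card A" arbitrary: A K L M rule: less_induct)
  case less
  note unf = K23_model_def branch_sets_def
  show ?case
  proof (cases "card A \<ge> 2")
    case False
    have "A \<noteq> {}" using less(2) by (auto simp: unf)
    then have "card A = 1" using False less.prems
      by (metis One_nat_def card_gt_0_iff Suc_leI le_antisym not_less_eq_eq numeral_2_eq_2)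
    then show ?thesis using less.prems(1) by (metis card_1_singletonE)
  next
    case True
    have "conn E A" using less(2) by (simp add: unf)
    from conn_noncut_vertex[OF \<open>finite A\<close> this True]
    obtain x where x: "x \<in> A" "conn E (A - {x})" "A - {x} \<noteq> {}" "touch E {x} (A - {x})"
      by blast
    let ?A = "A - {x}"
    have lt: "card ?A < card A" using card_Diff1_less[OF \<open>finite A\<close> x(1)] .
    have A: "A = {x} \<union> ?A" using x by auto
    have tx: "touch E ?A {x}" using x(4) touch_sym by metis
    have t: "touch E {x} U \<or> touch E ?A U" if "touch E A U" for U
      using that touch_Un1[of E "{x}" ?A] A by metis
    have c1: ?thesis if "K23_model E A B U V W" "touch E ?A U" "touch E ?A V" for U V W
    proof -
      have tW: "touch E {x} W \<or> touch E ?A W" using that t by (auto simp: unf)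
      show ?thesis
      proof (cases "touch E ?A W")
        case True
        then have "K23_model E ?A B U V W" using that x unfolding unf by auto
        then show ?thesis using less.hyps[OF lt] less.prems by blast
      next
        case False
        then have "touch E W {x}" using tW touch_sym by metis
        then have "conn E (W \<union> {x})" using that by (intro conn_Un) (simp_all add: unf)
        then have "K23_model E ?A B U V (W \<union> {x})"
          using that x tx unfolding unf by (auto simp: touch_Un2 simp del: Un_insert_right)
        then show ?thesis using less.hyps[OF lt] less.prems by blast
      qed
    qed
    have c2: ?thesis if "K23_model E A B U V W" "touch E {x} U" "touch E {x} V" for U V W
    proof -
      have tW: "touch E {x} W \<or> touch E ?A W" using that t by (auto simp: unf)
      show ?thesis
      proof (cases "touch E {x} W")
        case True
        then have "K23_model E {x} B U V W" using that x unfolding unf by auto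
        then show ?thesis by blast
      next
        case False
        then have "touch E W ?A" using tW touch_sym by metis
        then have "conn E (W \<union> ?A)" using that x by (intro conn_Un) (simp_all add: unf)
        then have "K23_model E {x} B U V (W \<union> ?A)"
          using that x tx unfolding unf by (auto simp: touch_Un2)
        then show ?thesis by blast
      qed
    qed
    have m: "K23_model E A B K M L" "K23_model E A B L M K"
      using less(2) K23_model_perm1 K23_model_perm2 by metis+
    have "touch E A K" "touch E A L" "touch E A M" using less(2) by (auto simp: unf)
    then show ?thesis using t c1 c2 m less(2) by metis
  qed
qed

lemma K23_model_shrink:
  assumes "K23_model E A B K L M" "finite A" "finite B"
  obtains a b K' L' M' where "K23_model E {a} {b} K' L' M'"
proof -
  obtain a K1 L1 M1 where 1: "K23_model E {a} B K1 L1 M1"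
    using K23_model_shrink_left assms by blast
  then show ?thesis
    using K23_model_shrink_left[OF K23_model_swap[OF 1] assms(3)] that K23_model_swap by blast
qed

section \<open>Contraction along an induced cycle\<close>

lemma conn_touch_covered:
  assumes "conn E S" "touch E S T" "s \<in> S"
  shows "s \<in> \<Union>E"
proof (cases "S = {s}")
  case True
  then show ?thesis using assms(2) by (auto simp: touch_def)
next
  case False
  then obtain t where t: "t \<in> S" "t \<notin> {s}" using assms(3) by blast
  obtain p q where "p \<in> {s}" "{p, q} \<in> E"
    using conn_cut[OF assms(1,3) _ t] by blast
  then show ?thesis by auto
qed

text \<open>Models mention no vertex set, but every branch set is connected and touches another one,
  so all its elements are ends of edges. This gives finiteness, containment in
  \<open>verts G\<close>, and the absence of \<open>u\<close> after \<open>u\<close> has been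
  identified with \<open>v\<close>.\<close>

lemma K23_model_covered:
  assumes "K23_model E A B K L M" "x \<in> A \<union> B \<union> K \<union> L \<union> M"
  shows "x \<in> \<Union>E"
proof -
  have t: "touch E A K" "touch E B K" "touch E K A" "touch E L A" "touch E M A"
    using assms(1) touch_sym unfolding K23_model_def by metis+
  have c: "conn E A" "conn E B" "conn E K" "conn E L" "conn E M"
    using assms(1) by (auto simp: K23_model_def branch_sets_def)
  show ?thesis
    using assms(2) conn_touch_covered[OF c(1) t(1)] conn_touch_covered[OF c(2) t(2)]
      conn_touch_covered[OF c(3) t(3)] conn_touch_covered[OF c(4) t(4)] conn_touch_covered[OF c(5) t(5)]
    by blast
qed

section \<open>Lifting models back through the identification of two vertices\<close>

definition contract_edges :: "'a set set \<Rightarrow> 'a \<Rightarrow> 'a \<Rightarrow> 'a set set" where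
  "contract_edges E u v = {e \<in> E. u \<notin> e} \<union> {{v, x} | x. {u, x} \<in> E}"

lemma contract_edges_off: "{x, y} \<in> contract_edges E u v \<Longrightarrow> x \<noteq> v \<Longrightarrow> y \<noteq> v \<Longrightarrow> {x, y} \<in> E"
  by (auto simp: contract_edges_def)

lemma contract_edges_at: "{v, y} \<in> contract_edges E u v \<Longrightarrow> y \<noteq> v \<Longrightarrow> {v, y} \<in> E \<or> {u, y} \<in> E"
  by (auto simp: contract_edges_def doubleton_eq_iff)

text \<open>Here \<open>X\<close> is a side of the cut vertex \<open>v\<close> of the contracted graph, and \<open>Q\<close> is a connected set
  on the other side that joins \<open>u\<close> to \<open>v\<close> when the contraction is undone.\<close>

definition lift_set :: "'a \<Rightarrow> 'a \<Rightarrow> 'a set \<Rightarrow> 'a set \<Rightarrow> 'a set \<Rightarrow> 'a set" where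
  "lift_set u v X Q S = (if v \<in> S then (S \<inter> X) \<union> ({u, v} \<union> Q) else S)"

locale side =
  fixes E :: "'a set set" and u v :: 'a and X Q :: "'a set"
  assumes closed: "\<And>x y. x \<in> X \<Longrightarrow> {x, y} \<in> E \<Longrightarrow> y \<in> X \<union> {u, v}"
    and notin: "u \<notin> X" "v \<notin> X" "u \<notin> Q" "v \<notin> Q" "u \<noteq> v"
    and Q: "conn E Q" "touch E {u} Q" "touch E {v} Q" "Q \<inter> X = {}"
begin

abbreviation "EH \<equiv> contract_edges E u v"

text \<open>A branch set that contains \<open>v\<close> may extend beyond \<open>X\<close>;
  \<open>lift_set\<close> discards that part and puts \<open>u\<close>, \<open>v\<close> and
  \<open>Q\<close> in its place.\<close>

abbreviation "good S \<equiv> u \<notin> S \<and> (v \<in> S \<or> S \<subseteq> X)"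

lemma conn_uvQ: "conn E ({u, v} \<union> Q)"
proof -
  have "conn E (insert v Q)" using Q by (simp add: conn_insert)
  moreover have "touch E {u} (insert v Q)" using Q by (auto simp: touch_def)
  ultimately have "conn E (insert u (insert v Q))" by (rule conn_insert)
  then show ?thesis by simp
qed

text \<open>By \<open>closed\<close>, a walk in \<open>S\<close> from a vertex of \<open>X\<close>
  stays in \<open>X\<close> until it reaches \<open>v\<close>. The edge by which it arrives comes
  from an edge of \<open>E\<close> to \<open>u\<close> or to \<open>v\<close>, and both of these lie
  in the connected set \<open>{u, v} \<union> Q\<close>.\<close>

lemma conn_lift:
  assumes "conn EH S" "good S"
  shows "conn E (lift_set u v X Q S)"
proof (cases "v \<in> S")
  case False
  then show ?thesis
    using assms conn_edges_cong[of EH S E] contract_edges_off[of _ _ E u v]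
    by (auto simp: lift_set_def)
next
  case True
  let ?L = "(S \<inter> X) \<union> ({u, v} \<union> Q)"
  have uv: "(u, v) \<in> (adj_on E ?L)\<^sup>*"
    using conn_uvQ adj_on_rtrancl_mono[of "{u, v} \<union> Q" ?L E E u v] by (auto simp: conn_def)
  have "conn E ?L"
  proof (rule connI_root[of _ v])
    fix x assume x: "x \<in> ?L"
    show "(v, x) \<in> (adj_on E ?L)\<^sup>*"
    proof (cases "x \<in> S \<inter> X")
      case False
      then have "x \<in> {u, v} \<union> Q" using x by blast
      then show ?thesis
        using conn_uvQ adj_on_rtrancl_mono[of "{u, v} \<union> Q" ?L E E v x] by (auto simp: conn_def)
    next
      case xX: True
      have "(x, v) \<in> (adj_on EH S)\<^sup>*" using assms(1) xX True by (auto simp: conn_def)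
      \<comment> \<open>Membership in \<open>X \<union> {v}\<close> is a premise of the induction
        claim because \<open>S\<close> may also contain vertices on the far side of
        \<open>v\<close>, for which nothing is asserted.\<close>
      then have "x \<in> X \<union> {v} \<Longrightarrow> (x, v) \<in> (adj_on E ?L)\<^sup>*"
      proof (induction rule: converse_rtrancl_induct)
        case base then show ?case by simp
      next
        case (step y z)
        show ?case
        proof (cases "y = v")
          case False
          then have y: "y \<in> X" "y \<in> S" using step by (auto simp: adj_on_def)
          have z: "z \<in> S" "{y, z} \<in> EH" "z \<noteq> u" using step assms(2) by (auto simp: adj_on_def)
          show ?thesis
          proof (cases "z = v")
            case True
            then have "{v, y} \<in> E \<or> {u, y} \<in> E"
              using contract_edges_at[of v y E u] z y False by (simp add: insert_commute)
            then have "(y, v) \<in> adj_on E ?L \<or> (y, u) \<in> adj_on E ?L"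
              using y by (auto simp: adj_on_def insert_commute)
            then show ?thesis using uv by (meson converse_rtrancl_into_rtrancl r_into_rtrancl)
          next
            case nz: False
            then have yz: "{y, z} \<in> E" using contract_edges_off z False by metis
            then have "z \<in> X" using closed[OF y(1)] z nz by auto
            then have "(y, z) \<in> adj_on E ?L" "(z, v) \<in> (adj_on E ?L)\<^sup>*"
              using y z yz step.IH by (auto simp: adj_on_def)
            then show ?thesis by (rule converse_rtrancl_into_rtrancl)
          qed
        qed simp
      qed
      then have "(x, v) \<in> (adj_on E ?L)\<^sup>*" using xX by simp
      then show ?thesis by (rule adj_on_rtrancl_sym)
    qed
  qed
  then show ?thesis using True by (simp add: lift_set_def)
qed

lemma touch_lift_aux:
  assumes "touch EH S T" "good S" "good T" "v \<in> S" "v \<notin> T"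
  shows "touch E (lift_set u v X Q S) (lift_set u v X Q T)"
proof -
  obtain s t where st: "s \<in> S" "t \<in> T" "{s, t} \<in> EH" using assms by (auto simp: touch_def)
  have t: "t \<in> X" "t \<noteq> v" using st assms by auto
  show ?thesis
  proof (cases "s = v")
    case True
    then have "{v, t} \<in> E \<or> {u, t} \<in> E" using contract_edges_at st t by metis
    then show ?thesis using assms st by (auto simp: touch_def lift_set_def)
  next
    case False
    then have e: "{s, t} \<in> E" using contract_edges_off st t by metis
    then have "s \<in> X" using closed[OF t(1), of s] False st assms(2) by (auto simp: insert_commute)
    then show ?thesis using e assms st by (auto simp: touch_def lift_set_def)
  qed
qed

lemma touch_lift:
  assumes "touch EH S T" "good S" "good T" "S \<inter> T = {}"
  shows "touch E (lift_set u v X Q S) (lift_set u v X Q T)"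
proof -
  consider "v \<in> S" "v \<notin> T" | "v \<notin> S" "v \<in> T" | "v \<notin> S" "v \<notin> T" using assms(4) by blast
  then show ?thesis
  proof cases
    case 1 then show ?thesis using touch_lift_aux assms by metis
  next
    case 2 then show ?thesis using touch_lift_aux[of T S] assms touch_sym by metis
  next
    case 3
    then show ?thesis using assms(1) contract_edges_off[of _ _ E u v]
      unfolding touch_def lift_set_def by metis
  qed
qed

lemma lift_disjoint: "good S \<Longrightarrow> good T \<Longrightarrow> S \<inter> T = {} \<Longrightarrow> lift_set u v X Q S \<inter> lift_set u v X Q T = {}"
  using notin Q(4) unfolding lift_set_def by auto

lemma lift_nonempty: "S \<noteq> {} \<Longrightarrow> lift_set u v X Q S \<noteq> {}"
  unfolding lift_set_def by auto

lemma K23_model_lift: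
  assumes "K23_model EH A B K L M" "good A" "good B" "good K" "good L" "good M"
  shows "has_K23 E"
proof -
  let ?f = "lift_set u v X Q"
  have "K23_model E (?f A) (?f B) (?f K) (?f L) (?f M)"
    using assms conn_lift touch_lift lift_disjoint lift_nonempty
    unfolding K23_model_def branch_sets_def by simp
  then show ?thesis by (rule has_K23I)
qed

end

text \<open>In the application \<open>R\<close> consists of the vertices other than \<open>u\<close>, \<open>w\<close>, \<open>v\<close> of an induced cycle through
  the path \<open>(u, w, v)\<close>.\<close>

lemma K23_across_cycle:
  assumes R: "conn E R" "R \<noteq> {}" "u \<notin> R" "v \<notin> R" "w \<notin> R" "touch E {u} R" "touch E {v} R"
    and uvw: "{u, w} \<in> E" "{w, v} \<in> E" "u \<noteq> v" "u \<noteq> w" "v \<noteq> w"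
    and wR: "\<not> touch E {w} R"
    and r: "r \<in> R" "r \<in> component_in E (- {u, v}) w"
  shows "has_K23 E"
proof -
  \<comment> \<open>Some path leads from \<open>w\<close> to \<open>R\<close> off \<open>u\<close>
    and \<open>v\<close>, and its interior is the wanted third branch set. It is obtained through
    components: \<open>?P\<close> is what \<open>w\<close> reaches in \<open>?W\<close> without
    entering \<open>R\<close>, and \<open>?Y\<close> below is a component of \<open>?P\<close>
    without \<open>w\<close> that still touches \<open>R\<close>.\<close>
  let ?W = "component_in E (- {u, v}) w"
  let ?P = "component_in E (?W - R) w"
  let ?N = "- {w} \<inter> ?P"
  have w: "w \<in> ?W" "w \<in> ?P" by (rule component_in_self)+
  have WS: "?W \<subseteq> - {u, v}" using uvw by (intro component_in_subset) auto
  have PS: "?P \<subseteq> ?W - R" using w R by (intro component_in_subset) auto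
  obtain p q where pq: "p \<in> ?W" "p \<in> ?P" "q \<in> ?W" "q \<notin> ?P" "{p, q} \<in> E"
    using conn_cut[OF conn_component_in w(1) w(2), of r] r PS by blast
  have qR: "q \<in> R" using component_in_closed[OF pq(2), of q] pq PS by blast
  \<comment> \<open>Inducedness of the cycle enters here: the vertex from which \<open>R\<close> is
    entered cannot be \<open>w\<close> itself, so removing \<open>w\<close> leaves it
    available.\<close>
  have pw: "p \<noteq> w" using wR qR pq by (auto simp: touch_def)
  let ?Y = "component_in E ?N p"
  have p: "p \<in> ?Y" by (rule component_in_self)
  have YS: "?Y \<subseteq> ?N" using pq pw by (intro component_in_subset) auto
  obtain a b where ab: "a \<in> ?P" "a \<in> ?Y" "b \<in> ?P" "b \<notin> ?Y" "{a, b} \<in> E"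
    using conn_cut[OF conn_component_in pq(2) p w(2)] YS by blast
  have "b = w" using component_in_closed[OF ab(2), of b] ab YS by blast
  have "K23_model E R {w} {u} {v} ?Y"
    unfolding K23_model_def branch_sets_def
  proof (simp, intro conjI)
    have "{q, p} \<in> E" "{w, a} \<in> E" using pq ab \<open>b = w\<close> by (simp_all add: insert_commute)
    then show "touch E R ?Y" "touch E {w} ?Y" using p qR ab(2) unfolding touch_def by blast+
    show "conn E ?Y" by (rule conn_component_in)
    show "R \<inter> ?Y = {}" "w \<notin> ?Y" "u \<notin> ?Y" "v \<notin> ?Y" using YS PS WS by auto
    show "?Y \<noteq> {}" using p by auto
    show "touch E R {u}" "touch E R {v}" using R touch_sym by metis+
    show "touch E {w} {u}" "touch E {w} {v}" using uvw by (auto simp: touch_def insert_commute)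
  qed (use R uvw in auto)
  then show ?thesis by (rule has_K23I)
qed

text \<open>The case split is whether \<open>{u, v}\<close> separates \<open>w\<close> from
  \<open>R\<close>. If it does, \<open>w\<close> and \<open>R\<close> lie on different sides, and
  each is connected and adjacent to both \<open>u\<close> and \<open>v\<close>; so whichever side
  carries the model, the opposite one supplies the set \<open>Q\<close> of the locale
  \<open>side\<close>.\<close>

lemma has_K23_contract_edges:
  assumes simple: "\<And>x. {x} \<notin> E"
    and R: "conn E R" "R \<noteq> {}" "u \<notin> R" "v \<notin> R" "w \<notin> R" "touch E {u} R" "touch E {v} R"
    and uvw: "{u, w} \<in> E" "{w, v} \<in> E" "u \<noteq> v"
    and wR: "\<not> touch E {w} R"
    and H: "has_K23 (contract_edges E u v)"
  shows "has_K23 E"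
proof (cases "R \<inter> component_in E (- {u, v}) w = {}")
  case False
  have "u \<noteq> w" "v \<noteq> w" using simple uvw by auto
  then show ?thesis using False K23_across_cycle[OF R uvw _ _ wR] by blast
next
  case RW: True
  let ?EH = "contract_edges E u v"
  let ?W = "component_in E (- {u, v}) w"
  let ?Z = "- (?W \<union> {u, v})"
  have ne: "u \<noteq> w" "v \<noteq> w" using simple uvw by auto
  have w: "w \<in> ?W" by (rule component_in_self)
  have WS: "?W \<subseteq> - {u, v}" using ne by (intro component_in_subset) auto
  have cW: "y \<in> ?W \<union> {u, v}" if "x \<in> ?W" "{x, y} \<in> E" for x y
    using component_in_closed[OF that(1), of y] that WS by blast
  have cZ: "y \<in> ?Z \<union> {u, v}" if "x \<in> ?Z" "{x, y} \<in> E" for x y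
    using cW[of y x] that by (auto simp: insert_commute)
  interpret W: side E u v ?W R
    using cW WS R uvw RW by unfold_locales auto
  interpret Z: side E u v ?Z "{w}"
    using cZ w ne uvw by unfold_locales (auto simp: touch_def insert_commute)
  obtain A B K L M where m: "K23_model ?EH A B K L M" using H by (auto simp: has_K23_def)
  have "u \<notin> \<Union>?EH" using simple uvw by (auto simp: contract_edges_def doubleton_eq_iff)
  then have u: "u \<notin> A" "u \<notin> B" "u \<notin> K" "u \<notin> L" "u \<notin> M"
    using K23_model_covered[OF m] by blast+
  have sides: "v \<in> S \<or> S \<subseteq> ?W \<or> S \<subseteq> ?Z" if "conn ?EH S" "u \<notin> S" for S
  proof (cases "v \<in> S \<or> S \<inter> ?W = {}")
    case False
    then have "conn E S"
      using that conn_edges_cong[of ?EH S E] contract_edges_off[of _ _ E u v] by auto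
    obtain s where s: "s \<in> S" "s \<in> ?W" using False by blast
    have "x \<in> ?W" if "x \<in> S" for x
    proof (rule ccontr)
      assume "x \<notin> ?W"
      then obtain p q where "p \<in> ?W" "q \<in> S" "q \<notin> ?W" "{p, q} \<in> E"
        using conn_cut[OF \<open>conn E S\<close> s \<open>x \<in> S\<close>] by blast
      then show False using cW[of p q] False \<open>u \<notin> S\<close> by auto
    qed
    then show ?thesis by blast
  qed (use that in auto)
  have tch: "v \<in> S \<or> v \<in> T \<or> \<not> (S \<subseteq> ?W \<and> T \<subseteq> ?Z) \<and> \<not> (S \<subseteq> ?Z \<and> T \<subseteq> ?W)"
    if "touch ?EH S T" for S T
  proof (cases "v \<in> S \<or> v \<in> T")
    case False
    obtain s t where st: "s \<in> S" "t \<in> T" "{s, t} \<in> ?EH" using \<open>touch ?EH S T\<close> by (auto simp: touch_def)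
    then have "{s, t} \<in> E" using False contract_edges_off by metis
    then have "s \<in> ?W \<Longrightarrow> t \<in> ?W \<union> {u, v}" "s \<in> ?Z \<Longrightarrow> t \<in> ?Z \<union> {u, v}" using cW cZ by metis+
    then show ?thesis using st(1,2) WS by blast
  qed auto
  have c: "conn ?EH A" "conn ?EH B" "conn ?EH K" "conn ?EH L" "conn ?EH M"
    and d: "v \<notin> A \<or> v \<notin> B" "v \<notin> A \<or> v \<notin> K" "v \<notin> A \<or> v \<notin> L" "v \<notin> A \<or> v \<notin> M"
     "v \<notin> B \<or> v \<notin> K" "v \<notin> B \<or> v \<notin> L" "v \<notin> B \<or> v \<notin> M" "v \<notin> K \<or> v \<notin> L" "v \<notin> K \<or> v \<notin> M" "v \<notin> L \<or> v \<notin> M"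
    and t: "touch ?EH A K" "touch ?EH A L" "touch ?EH A M" "touch ?EH B K" "touch ?EH B L" "touch ?EH B M"
    using m by (auto simp: K23_model_def branch_sets_def)
  \<comment> \<open>At most one branch set contains \<open>v\<close>, and K_{2,3} stays connected
    when any one vertex is removed. Hence the sets without \<open>v\<close> all lie on the same
    side; what remains is propositional.\<close>
  have "(W.good A \<and> W.good B \<and> W.good K \<and> W.good L \<and> W.good M) \<or>
     (Z.good A \<and> Z.good B \<and> Z.good K \<and> Z.good L \<and> Z.good M)"
    using u d sides[OF c(1) u(1)] sides[OF c(2) u(2)] sides[OF c(3) u(3)] sides[OF c(4) u(4)]
      sides[OF c(5) u(5)] tch[OF t(1)] tch[OF t(2)] tch[OF t(3)] tch[OF t(4)] tch[OF t(5)] tch[OF t(6)]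
    by argo
  then show ?thesis using W.K23_model_lift[OF m] Z.K23_model_lift[OF m] by blast
qed

section \<open>Cycles up to rotation, and contraction in graphs\<close>

lemma cycle_edges_rotate1: "cycle_edges (rotate1 c) = cycle_edges c"
proof (cases c)
  case (Cons x xs)
  show ?thesis
  proof (cases "xs = []")
    case False
    have "cycle_edges (rotate1 c) = path_edges ((xs @ [x]) @ [hd xs])"
      using Cons False by (simp add: cycle_edges_eq)
    also have "\<dots> = insert {x, hd xs} (path_edges (xs @ [x]))"
      by (subst path_edges_append_single) auto
    also have "\<dots> = cycle_edges c"
      using Cons False by (simp add: cycle_edges_eq path_edges_Cons)
    finally show ?thesis .
  qed (simp add: Cons)
qed simp

lemma cycle_edges_rotate: "cycle_edges (rotate n c) = cycle_edges c"
  by (induction n) (simp_all add: rotate_def cycle_edges_rotate1)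

lemma rotate_to_front:
  assumes "x \<in> set c"
  obtains n xs where "rotate n c = x # xs"
proof -
  obtain ys zs where "c = ys @ x # zs" using assms by (meson split_list)
  then have "rotate (length ys) c = x # (zs @ ys)" by (simp add: rotate_append)
  then show ?thesis using that by blast
qed

lemma simple_graph_no_loop: "simple_graph G \<Longrightarrow> {x} \<notin> edges G"
  unfolding simple_graph_def by (metis doubleton_eq_iff insert_absorb2)

text \<open>After rotating \<open>w\<close> to the front, \<open>u\<close> and \<open>v\<close> are
  the first and the last of the remaining vertices, and \<open>R\<close> is the set of those between
  them. It is nonempty because \<open>u\<close> and \<open>v\<close> are nonadjacent, and
  \<open>w\<close> has no neighbour in it because the cycle is induced.\<close>

lemma has_K23_contract:
  assumes G: "simple_graph G" and c: "induced_cycle G c"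
    and uvw: "{u, w} \<in> cycle_edges c" "{w, v} \<in> cycle_edges c" "u \<noteq> v" "{u, v} \<notin> edges G"
    and H: "has_K23 (edges (contract G u v))"
  shows "has_K23 (edges G)"
proof -
  let ?E = "edges G"
  have cy: "length c \<ge> 3" "distinct c" "cycle_edges c \<subseteq> ?E"
    using c by (auto simp: induced_cycle_def is_cycle_def)
  have chord: "{x, y} \<in> cycle_edges c" if "x \<in> set c" "y \<in> set c" "{x, y} \<in> ?E" for x y
    using c that by (auto simp: induced_cycle_def)
  have "c \<noteq> []" using cy by auto
  then have "w \<in> set c" using uvw path_edges_subset[of "{u, w}" "c @ [hd c]"] by (auto simp: cycle_edges_eq)
  then obtain n xs where rot: "rotate n c = w # xs" by (rule rotate_to_front)
  have xs: "length xs \<ge> 2" "distinct (w # xs)" "set c = set (w # xs)"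
    "cycle_edges c = path_edges (w # xs @ [w])"
  proof -
    show "length xs \<ge> 2" using cy rot length_rotate[of n c] by simp
    show "distinct (w # xs)" using cy rot distinct_rotate[of n c] by simp
    show "set c = set (w # xs)" using rot set_rotate[of n c] by simp
    show "cycle_edges c = path_edges (w # xs @ [w])"
      using cycle_edges_rotate[of n c] rot by (simp add: cycle_edges_eq)
  qed
  obtain a b ys where ys: "xs = a # ys @ [b]"
  proof -
    obtain a zs where "xs = a # zs" "zs \<noteq> []" using xs(1) by (cases xs) (auto simp: Suc_le_eq)
    then show ?thesis using that[of a "butlast zs" "last zs"] by simp
  qed
  have ce: "cycle_edges c = {{w, a}, {b, w}} \<union> path_edges (a # ys @ [b])"
    using path_edges_append_single[of "a # ys @ [b]" w] unfolding xs(4) ys by simp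
  have nb: "x = a \<or> x = b" if "{w, x} \<in> cycle_edges c" for x
  proof -
    have "{w, x} \<notin> path_edges (a # ys @ [b])"
      using path_edges_subset[of "{w, x}" "a # ys @ [b]"] xs(2) ys by auto
    then show ?thesis using that ce by (auto simp: doubleton_eq_iff)
  qed
  have "u = a \<or> u = b" "v = a \<or> v = b" using nb uvw by (auto simp: insert_commute)
  then have uv: "{u, v} = {a, b}" using uvw by auto
  have ysne: "ys \<noteq> []"
  proof
    assume "ys = []"
    then have "{a, b} \<in> ?E" using ce cy by auto
    then show False using uv uvw by simp
  qed
  have pe: "{a, hd ys} \<in> ?E" "{last ys, b} \<in> ?E" "path_edges ys \<subseteq> ?E"
    using ce cy(3) ysne by (auto simp: path_edges_append path_edges_Cons)
  have tab: "touch ?E {a} (set ys)" "touch ?E {b} (set ys)"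
    using pe ysne hd_in_set[OF ysne] last_in_set[OF ysne] by (auto simp: touch_def insert_commute)
  have "\<not> touch ?E {w} (set ys)"
  proof
    assume "touch ?E {w} (set ys)"
    then obtain y where y: "y \<in> set ys" "{w, y} \<in> ?E" by (auto simp: touch_def)
    then have "{w, y} \<in> cycle_edges c" using chord xs(3) ys by auto
    then have "y = a \<or> y = b" by (rule nb)
    then show False using y(1) xs(2) ys by auto
  qed
  moreover have "touch ?E {u} (set ys)" "touch ?E {v} (set ys)"
    using tab \<open>u = a \<or> u = b\<close> \<open>v = a \<or> v = b\<close> by auto
  moreover have "u \<notin> set ys" "v \<notin> set ys" "w \<notin> set ys"
    using \<open>u = a \<or> u = b\<close> \<open>v = a \<or> v = b\<close> xs(2) ys by auto
  moreover have "{u, w} \<in> ?E" "{w, v} \<in> ?E" using uvw cy by auto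
  moreover have "has_K23 (contract_edges ?E u v)" using H by (simp add: contract_def contract_edges_def)
  ultimately show ?thesis
    using has_K23_contract_edges[of ?E "set ys" u v w] simple_graph_no_loop[OF G] conn_path[OF pe(3)] ysne uvw(3) by auto
qed

section \<open>Bipartite minors\<close>

lemma has_K23_mono: "has_K23 E \<Longrightarrow> E \<subseteq> F \<Longrightarrow> has_K23 F"
proof -
  assume "has_K23 E" "E \<subseteq> F"
  then obtain A B K L M where m: "K23_model E A B K L M" by (auto simp: has_K23_def)
  have "conn E S \<Longrightarrow> conn F S" for S using \<open>E \<subseteq> F\<close> by (meson conn_edges_cong subsetD)
  moreover have "touch E S T \<Longrightarrow> touch F S T" for S T using \<open>E \<subseteq> F\<close> by (auto simp: touch_def)
  ultimately have "K23_model F A B K L M" using m by (simp add: K23_model_def branch_sets_def)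
  then show ?thesis by (rule has_K23I)
qed

lemma simple_graph_edge_verts: "simple_graph G \<Longrightarrow> {x, y} \<in> edges G \<Longrightarrow> x \<in> verts G \<and> y \<in> verts G \<and> x \<noteq> y"
  unfolding simple_graph_def by (metis doubleton_eq_iff)

lemma simple_graph_edgeE:
  assumes "simple_graph G" "e \<in> edges G"
  obtains x y where "e = {x, y}" "x \<in> verts G" "y \<in> verts G" "x \<noteq> y"
  using assms unfolding simple_graph_def by metis

lemma simple_graph_subgraph:
  assumes "simple_graph G" "V \<subseteq> verts G" "E \<subseteq> edges G" "\<Union>E \<subseteq> V"
  shows "simple_graph \<lparr>verts = V, edges = E\<rparr>"
proof -
  have "\<exists>x\<in>V. \<exists>y\<in>V. x \<noteq> y \<and> e = {x, y}" if "e \<in> E" for e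
  proof -
    have "e \<in> edges G" using assms(3) that by blast
    then obtain x y where "e = {x, y}" "x \<noteq> y" by (rule simple_graph_edgeE[OF assms(1)])
    moreover from this have "x \<in> V" "y \<in> V" using assms(4) that by blast+
    ultimately show ?thesis by blast
  qed
  moreover have "finite V" using assms(1,2) finite_subset by (auto simp: simple_graph_def)
  ultimately show ?thesis by (simp add: simple_graph_def)
qed

lemma bipartite_subgraph:
  assumes "bipartite G" "V \<subseteq> verts G" "E \<subseteq> edges G" "\<Union>E \<subseteq> V"
  shows "bipartite \<lparr>verts = V, edges = E\<rparr>"
proof -
  obtain X Y where "bipartition G X Y" using assms by (auto simp: bipartite_def)
  then have XY: "X \<union> Y = verts G" "X \<inter> Y = {}" "\<And>e. e \<in> edges G \<Longrightarrow> \<exists>x\<in>X. \<exists>y\<in>Y. e = {x, y}"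
    by (auto simp: bipartition_def)
  have "\<exists>x\<in>X \<inter> V. \<exists>y\<in>Y \<inter> V. e = {x, y}" if "e \<in> E" for e
  proof -
    have "e \<in> edges G" using assms(3) that by blast
    from XY(3)[OF this] obtain x y where "e = {x, y}" "x \<in> X" "y \<in> Y" by blast
    moreover from this have "x \<in> V" "y \<in> V" using assms(4) that by blast+
    ultimately show ?thesis by blast
  qed
  moreover have "X \<inter> V \<union> Y \<inter> V = V" "(X \<inter> V) \<inter> (Y \<inter> V) = {}" using XY(1,2) assms(2) by auto
  ultimately have "bipartition \<lparr>verts = V, edges = E\<rparr> (X \<inter> V) (Y \<inter> V)"
    by (simp add: bipartition_def)
  then show ?thesis by (auto simp: bipartite_def)
qed

lemma bipartition_edge: "bipartition G X Y \<Longrightarrow> {x, y} \<in> edges G \<Longrightarrow> x \<in> X \<longleftrightarrow> y \<notin> X"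
proof -
  assume G: "bipartition G X Y" "{x, y} \<in> edges G"
  then obtain a b where "{x, y} = {a, b}" "a \<in> X" "b \<in> Y" by (auto simp: bipartition_def)
  then show ?thesis using G(1) by (auto simp: bipartition_def doubleton_eq_iff)
qed

lemma bipartition_swap: "bipartition G X Y \<Longrightarrow> bipartition G Y X"
  unfolding bipartition_def by (metis Int_commute Un_commute insert_commute)

lemma simple_graph_contract:
  assumes "simple_graph G" "u \<in> verts G" "v \<in> verts G" "u \<noteq> v" "{u, v} \<notin> edges G"
  shows "simple_graph (contract G u v)"
proof -
  have "\<exists>x\<in>verts G - {u}. \<exists>y\<in>verts G - {u}. x \<noteq> y \<and> e = {x, y}"
    if "e \<in> edges (contract G u v)" for e
  proof -
    consider "e \<in> edges G" "u \<notin> e" | x where "e = {v, x}" "{u, x} \<in> edges G"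
      using \<open>e \<in> edges (contract G u v)\<close> by (auto simp: contract_def)
    then show ?thesis
    proof cases
      case 1
      then obtain x y where "e = {x, y}" "x \<in> verts G" "y \<in> verts G" "x \<noteq> y"
        using simple_graph_edgeE assms(1) by metis
      then show ?thesis using 1 by blast
    next
      case 2
      then have "x \<in> verts G - {u}" "v \<noteq> x" using simple_graph_edge_verts[OF assms(1) 2(2)] assms(5) by auto
      then show ?thesis using 2(1) assms(3,4) by blast
    qed
  qed
  then show ?thesis using assms(1) by (simp add: simple_graph_def contract_def)
qed

lemma bipartite_contract:
  assumes "simple_graph G" "bipartition G X Y" "u \<in> X" "v \<in> X" "u \<noteq> v"
  shows "bipartite (contract G u v)"
proof -
  have "\<exists>x\<in>X - {u}. \<exists>y\<in>Y. e = {x, y}" if "e \<in> edges (contract G u v)" for e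
  proof -
    consider "e \<in> edges G" "u \<notin> e" | x where "e = {v, x}" "{u, x} \<in> edges G"
      using \<open>e \<in> edges (contract G u v)\<close> by (auto simp: contract_def)
    then show ?thesis
    proof cases
      case 1
      then show ?thesis using assms(2) unfolding bipartition_def by fastforce
    next
      case 2
      then have "x \<in> Y"
        using assms(1-3) bipartition_edge[OF assms(2) 2(2)] simple_graph_edge_verts[OF assms(1) 2(2)]
        by (auto simp: bipartition_def)
      then show ?thesis using 2 assms by auto
    qed
  qed
  moreover have "X - {u} \<union> Y = verts G - {u}" using assms by (auto simp: bipartition_def)
  moreover have "(X - {u}) \<inter> Y = {}" using assms by (auto simp: bipartition_def)
  ultimately have "bipartition (contract G u v) (X - {u}) Y"
    unfolding bipartition_def by (simp add: contract_def)
  then show ?thesis by (auto simp: bipartite_def)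
qed

text \<open>Simplicity and bipartiteness are carried along so that the next step of a sequence finds
  the same hypotheses. In a contraction \<open>u\<close> and \<open>v\<close> lie in one part and
  are therefore nonadjacent, as \<open>has_K23_contract\<close> demands.\<close>

lemma minor_step_invariants:
  assumes "bipartite_minor_step G H" "simple_graph G" "bipartite G"
  shows "simple_graph H \<and> bipartite H \<and> (has_K23 (edges H) \<longrightarrow> has_K23 (edges G))"
  using assms
proof cases
  case (del_vertex v)
  have "\<Union>{e \<in> edges G. e \<inter> {v} = {}} \<subseteq> verts G - {v}"
    using assms(2) unfolding simple_graph_def by fastforce
  then show ?thesis
    using del_vertex assms has_K23_mono[of "edges H" "edges G"]
      simple_graph_subgraph[of G "verts G - {v}" "{e \<in> edges G. e \<inter> {v} = {}}"]
      bipartite_subgraph[of G "verts G - {v}" "{e \<in> edges G. e \<inter> {v} = {}}"]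
    by (auto simp: delete_verts_def)
next
  case (del_edge e)
  have "\<Union>(edges G - {e}) \<subseteq> verts G"
    using assms(2) unfolding simple_graph_def by fastforce
  then show ?thesis
    using del_edge assms has_K23_mono[of "edges H" "edges G"]
      simple_graph_subgraph[of G "verts G" "edges G - {e}"]
      bipartite_subgraph[of G "verts G" "edges G - {e}"]
    by (auto simp: delete_edge_def)
next
  case (contraction u v)
  then obtain X Y w c where h: "u \<noteq> v" "bipartition G X Y" "u \<in> X" "v \<in> X" "induced_cycle G c"
     "{u, w} \<in> cycle_edges c" "{w, v} \<in> cycle_edges c"
    unfolding admissible_def peripheral_cycle_def by blast
  have "{u, v} \<notin> edges G" using bipartition_edge[OF h(2)] h by auto
  moreover have "u \<in> verts G" "v \<in> verts G" using h by (auto simp: bipartition_def)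
  ultimately show ?thesis
    using contraction simple_graph_contract[of G u v] bipartite_contract[OF assms(2) h(2-4,1)]
      has_K23_contract[OF assms(2) h(5-7,1)] assms(2) h(1) by simp
qed

lemma has_K23_isomorphic_K23:
  assumes "isomorphic G (complete_bipartite 2 3)"
  shows "has_K23 (edges G)"
proof -
  let ?K = "complete_bipartite 2 3"
  obtain f where f: "bij_betw f (verts G) (verts ?K)"
    and ed: "\<And>u v. u \<in> verts G \<Longrightarrow> v \<in> verts G \<Longrightarrow> {u, v} \<in> edges G \<longleftrightarrow> {f u, f v} \<in> edges ?K"
    using assms unfolding isomorphic_def by blast
  define g where "g = inv_into (verts G) f"
  have g: "g y \<in> verts G" "f (g y) = y" if "y \<in> verts ?K" for y
    using that f unfolding g_def bij_betw_def by (auto simp: inv_into_into f_inv_into_f)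
  let ?l = "\<lambda>i. g (Inl i)" and ?r = "\<lambda>j. g (Inr j)"
  have v: "Inl i \<in> verts ?K" if "i < 2" for i using that by (auto simp: complete_bipartite_def)
  have w: "Inr j \<in> verts ?K" if "j < 3" for j using that by (auto simp: complete_bipartite_def)
  have e: "{?l i, ?r j} \<in> edges G" if "i < 2" "j < 3" for i j
    using ed[OF g(1)[OF v[OF that(1)]] g(1)[OF w[OF that(2)]]] g(2)[OF v[OF that(1)]] g(2)[OF w[OF that(2)]] that
    by (auto simp: complete_bipartite_def)
  have ne: "g y \<noteq> g z" if "y \<in> verts ?K" "z \<in> verts ?K" "y \<noteq> z" for y z
    using g that by metis
  have "K23_model (edges G) {?l 0} {?l 1} {?r 0} {?r 1} {?r 2}"
    unfolding K23_model_def branch_sets_def touch_def using e ne v w by simp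
  then show ?thesis by (rule has_K23I)
qed

lemma bipartite_minor_K23_imp_has_K23:
  assumes "simple_graph G" "bipartite G" "bipartite_minor (complete_bipartite 2 3) G"
  shows "has_K23 (edges G)"
proof -
  obtain H where H: "bipartite_minor_step\<^sup>*\<^sup>* G H" "isomorphic H (complete_bipartite 2 3)"
    using assms(3) by (auto simp: bipartite_minor_def)
  from H(1) assms(1,2) show ?thesis
  proof (induction rule: converse_rtranclp_induct)
    case base
    then show ?case using has_K23_isomorphic_K23 H(2) by blast
  next
    case (step F F')
    then show ?case using minor_step_invariants by blast
  qed
qed

section \<open>Reduction of theta graphs to K23\<close>

lemma minor_steps_delete_edges:
  assumes "finite F" "F \<subseteq> E"
  shows "bipartite_minor_step\<^sup>*\<^sup>* \<lparr>verts = V, edges = E\<rparr> \<lparr>verts = V, edges = E - F\<rparr>"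
  using assms
proof (induction F)
  case (insert e F)
  then have "bipartite_minor_step \<lparr>verts = V, edges = E - F\<rparr> (delete_edge \<lparr>verts = V, edges = E - F\<rparr> e)"
    by (intro bipartite_minor_step.del_edge) auto
  moreover have "delete_edge \<lparr>verts = V, edges = E - F\<rparr> e = \<lparr>verts = V, edges = E - insert e F\<rparr>"
    by (auto simp: delete_edge_def)
  ultimately show ?case using insert by (auto intro: rtranclp.rtrancl_into_rtrancl)
qed simp

lemma minor_steps_delete_verts:
  assumes "finite D" "D \<subseteq> V" "D \<inter> \<Union>E = {}"
  shows "bipartite_minor_step\<^sup>*\<^sup>* \<lparr>verts = V, edges = E\<rparr> \<lparr>verts = V - D, edges = E\<rparr>"
  using assms
proof (induction D)
  case (insert v D)
  then have "bipartite_minor_step \<lparr>verts = V - D, edges = E\<rparr> (delete_verts \<lparr>verts = V - D, edges = E\<rparr> {v})"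
    by (intro bipartite_minor_step.del_vertex) auto
  moreover have "delete_verts \<lparr>verts = V - D, edges = E\<rparr> {v} = \<lparr>verts = V - insert v D, edges = E\<rparr>"
    using insert by (auto simp: delete_verts_def)
  ultimately show ?case using insert by (auto intro: rtranclp.rtrancl_into_rtrancl)
qed simp

lemma minor_steps_subgraph:
  assumes "simple_graph G" "V \<subseteq> verts G" "E \<subseteq> edges G" "\<Union>E \<subseteq> V"
  shows "bipartite_minor_step\<^sup>*\<^sup>* G \<lparr>verts = V, edges = E\<rparr>"
proof -
  have fv: "finite (verts G)" using assms by (simp add: simple_graph_def)
  have "edges G \<subseteq> Pow (verts G)" using assms(1) unfolding simple_graph_def by fastforce
  then have "finite (edges G)" using fv by (meson finite_Pow_iff finite_subset)
  then have "bipartite_minor_step\<^sup>*\<^sup>* \<lparr>verts = verts G, edges = edges G\<rparr>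
      \<lparr>verts = verts G, edges = edges G - (edges G - E)\<rparr>"
    by (intro minor_steps_delete_edges) auto
  also have "edges G - (edges G - E) = E" using assms by auto
  also have "bipartite_minor_step\<^sup>*\<^sup>* \<lparr>verts = verts G, edges = E\<rparr>
      \<lparr>verts = verts G - (verts G - V), edges = E\<rparr>"
    using fv assms by (intro minor_steps_delete_verts) auto
  also have "verts G - (verts G - V) = V" using assms by auto
  also have "\<lparr>verts = verts G, edges = edges G\<rparr> = G" by simp
  finally show ?thesis .
qed

text \<open>The lists hold only the inner vertices of the three paths from \<open>a\<close> to
  \<open>b\<close>. Since none of them is empty, these graphs are exactly the subdivisions of
  K_{2,3}.\<close>

definition theta_graph :: "'a ugraph \<Rightarrow> 'a \<Rightarrow> 'a \<Rightarrow> 'a list \<Rightarrow> 'a list \<Rightarrow> 'a list \<Rightarrow> bool" where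
  "theta_graph G a b P Q R \<longleftrightarrow> distinct (a # b # P @ Q @ R) \<and> P \<noteq> [] \<and> Q \<noteq> [] \<and> R \<noteq> [] \<and>
     verts G = set (a # b # P @ Q @ R) \<and>
     edges G = path_edges (a # P @ [b]) \<union> path_edges (a # Q @ [b]) \<union> path_edges (a # R @ [b])"

lemma theta_graph_perm1: "theta_graph G a b P Q R \<Longrightarrow> theta_graph G a b Q P R"
  and theta_graph_perm2: "theta_graph G a b P Q R \<Longrightarrow> theta_graph G a b P R Q"
  unfolding theta_graph_def by auto

lemma path_edges_Cons_snoc:
  "P \<noteq> [] \<Longrightarrow> path_edges (a # P @ [b]) = insert {a, hd P} (insert {last P, b} (path_edges P))"
  by (simp add: path_edges_Cons path_edges_append_single)

lemma path_edges_snoc_edges: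
  assumes "conn E K" "touch E {a} K" "touch E {b} K"
  obtains P where "P \<noteq> []" "distinct P" "set P \<subseteq> K" "path_edges (a # P @ [b]) \<subseteq> E"
proof -
  obtain x y where x: "x \<in> K" "{a, x} \<in> E" and y: "y \<in> K" "{b, y} \<in> E"
    using assms by (auto simp: touch_def)
  obtain P where "P \<noteq> []" "hd P = x" "last P = y" "distinct P" "set P \<subseteq> K" "path_edges P \<subseteq> E"
    using conn_obtain_path[OF assms(1) x(1) y(1)] .
  then show ?thesis using that[of P] x y by (simp add: path_edges_Cons_snoc insert_commute)
qed

text \<open>Once two branch sets are shrunk to the vertices \<open>a\<close> and \<open>b\<close>, a
  path through each of the other three, from a neighbour of \<open>a\<close> to a neighbour of
  \<open>b\<close>, completes the theta graph.\<close>

lemma obtain_theta_subgraph: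
  assumes "simple_graph G" "has_K23 (edges G)"
  obtains T a b P Q R where "theta_graph T a b P Q R" "verts T \<subseteq> verts G" "edges T \<subseteq> edges G"
    "\<Union>(edges T) \<subseteq> verts T"
proof -
  let ?E = "edges G"
  obtain A B K L M where m: "K23_model ?E A B K L M" using assms(2) by (auto simp: has_K23_def)
  have V: "\<Union>?E \<subseteq> verts G" using assms(1) unfolding simple_graph_def by fastforce
  have "finite (\<Union>?E)" using V assms(1) finite_subset by (auto simp: simple_graph_def)
  moreover have "A \<subseteq> \<Union>?E" "B \<subseteq> \<Union>?E" using K23_model_covered[OF m] by blast+
  ultimately have "finite A" "finite B" using finite_subset by auto
  then obtain a b K L M where m: "K23_model ?E {a} {b} K L M" using K23_model_shrink[OF m] by blast
  have c: "conn ?E K" "conn ?E L" "conn ?E M"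
    and t: "touch ?E {a} K" "touch ?E {b} K" "touch ?E {a} L" "touch ?E {b} L" "touch ?E {a} M" "touch ?E {b} M"
    and d: "a \<noteq> b" "a \<notin> K" "a \<notin> L" "a \<notin> M" "b \<notin> K" "b \<notin> L" "b \<notin> M" "K \<inter> L = {}" "K \<inter> M = {}" "L \<inter> M = {}"
    using m by (auto simp: K23_model_def branch_sets_def)
  obtain P where P: "P \<noteq> []" "distinct P" "set P \<subseteq> K" "path_edges (a # P @ [b]) \<subseteq> ?E"
    using path_edges_snoc_edges[OF c(1) t(1,2)] .
  obtain Q where Q: "Q \<noteq> []" "distinct Q" "set Q \<subseteq> L" "path_edges (a # Q @ [b]) \<subseteq> ?E"
    using path_edges_snoc_edges[OF c(2) t(3,4)] .
  obtain R where R: "R \<noteq> []" "distinct R" "set R \<subseteq> M" "path_edges (a # R @ [b]) \<subseteq> ?E"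
    using path_edges_snoc_edges[OF c(3) t(5,6)] .
  let ?T = "\<lparr>verts = set (a # b # P @ Q @ R),
     edges = path_edges (a # P @ [b]) \<union> path_edges (a # Q @ [b]) \<union> path_edges (a # R @ [b])\<rparr>"
  have "distinct (a # b # P @ Q @ R)" using P Q R d by auto
  then have "theta_graph ?T a b P Q R" using P Q R unfolding theta_graph_def by simp
  moreover have "verts ?T \<subseteq> verts G"
  proof -
    have "set (a # b # P @ Q @ R) \<subseteq> \<Union>?E"
      using P(3) Q(3) R(3) K23_model_covered[OF m] by auto
    then show ?thesis using V by auto
  qed
  moreover have "edges ?T \<subseteq> ?E" using P Q R by auto
  moreover have "\<Union>(edges ?T) \<subseteq> verts ?T"
    using path_edges_subset[of _ "a # P @ [b]"] path_edges_subset[of _ "a # Q @ [b]"]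
      path_edges_subset[of _ "a # R @ [b]"] by fastforce
  ultimately show ?thesis by (rule that)
qed

section \<open>Peripheral cycles of theta graphs and contractions along them\<close>

lemma card_graph_components_conn:
  assumes "conn (edges G) (verts G)"
  shows "card (graph_components G) \<le> 1"
proof -
  let ?r = "{(x, y). x \<in> verts G \<and> y \<in> verts G \<and> (x, y) \<in> {(a, b). {a, b} \<in> edges G}\<^sup>*}"
  have "?r `` {x} = verts G" if "x \<in> verts G" for x
  proof -
    have "adj_on (edges G) (verts G) \<subseteq> {(a, b). {a, b} \<in> edges G}" by (auto simp: adj_on_def)
    then have "(x, y) \<in> {(a, b). {a, b} \<in> edges G}\<^sup>*" if "y \<in> verts G" for y
      using assms \<open>x \<in> verts G\<close> that rtrancl_mono unfolding conn_def by blast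
    then show ?thesis using that by auto
  qed
  then have "graph_components G \<subseteq> {verts G}" by (auto simp: graph_components_def quotient_def)
  then show ?thesis using card_mono[of "{verts G}"] by force
qed

lemma card_graph_components_pos:
  assumes "finite (verts G)" "verts G \<noteq> {}"
  shows "card (graph_components G) \<ge> 1"
proof -
  have "finite (graph_components G)" "graph_components G \<noteq> {}"
    using assms by (auto simp: graph_components_def quotient_def)
  then show ?thesis by (simp add: Suc_le_eq card_gt_0_iff)
qed

text \<open>Every edge off the cycle belongs to the third path and has an inner vertex of it as an
  end, since \<open>R\<close> is nonempty; so there is no chord. Deleting the cycle leaves the
  connected path \<open>R\<close>.\<close>

lemma theta_peripheral:
  assumes "theta_graph G a b P Q R"
  shows "peripheral_cycle G (a # P @ b # rev Q)"
    and "cycle_edges (a # P @ b # rev Q) = path_edges (a # P @ [b]) \<union> path_edges (a # Q @ [b])"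
proof -
  let ?c = "a # P @ b # rev Q"
  have d: "distinct (a # b # P @ Q @ R)" and ne: "P \<noteq> []" "Q \<noteq> []" "R \<noteq> []"
    and V: "verts G = set (a # b # P @ Q @ R)"
    and E: "edges G = path_edges (a # P @ [b]) \<union> path_edges (a # Q @ [b]) \<union> path_edges (a # R @ [b])"
    using assms by (auto simp: theta_graph_def)
  have "cycle_edges ?c = path_edges ((a # P) @ (b # rev Q @ [a]))"
    by (simp add: cycle_edges_eq)
  also have "\<dots> = insert {last (a # P), b} (path_edges (a # P)) \<union> path_edges (rev (a # Q @ [b]))"
    by (subst path_edges_append) auto
  also have "insert {last (a # P), b} (path_edges (a # P)) = path_edges ((a # P) @ [b])"
    by (subst path_edges_append_single) auto
  finally show ce: "cycle_edges ?c = path_edges (a # P @ [b]) \<union> path_edges (a # Q @ [b])"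
    by (simp only: path_edges_rev append_Cons)
  have "is_cycle G ?c"
    unfolding is_cycle_def using d ne V E ce by (cases P) auto
  moreover have "{x, y} \<notin> edges G" if "x \<in> set ?c" "y \<in> set ?c" "{x, y} \<notin> cycle_edges ?c" for x y
  proof
    assume "{x, y} \<in> edges G"
    then have "{x, y} \<in> path_edges (a # R @ [b])" using that(3) E ce by blast
    then consider "{x, y} \<in> path_edges R" | "hd R \<in> {x, y}" | "last R \<in> {x, y}"
      unfolding path_edges_Cons_snoc[OF ne(3)] by blast
    then have "x \<in> set R \<or> y \<in> set R"
      using path_edges_subset[of "{x, y}" R] hd_in_set[OF ne(3)] last_in_set[OF ne(3)] by cases auto
    then show False using that(1,2) d by auto
  qed
  moreover have "non_separating G ?c"
  proof -
    have vc: "verts (delete_verts G (set ?c)) = set R" using d V by (auto simp: delete_verts_def)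
    have "path_edges R \<subseteq> edges (delete_verts G (set ?c))"
    proof
      fix e assume e: "e \<in> path_edges R"
      then have "e \<subseteq> set R" by (rule path_edges_subset)
      then show "e \<in> edges (delete_verts G (set ?c))"
        using e d E ne(3) by (auto simp: delete_verts_def path_edges_Cons_snoc)
    qed
    then have "conn (edges (delete_verts G (set ?c))) (verts (delete_verts G (set ?c)))"
      unfolding vc by (rule conn_path)
    then have "card (graph_components (delete_verts G (set ?c))) \<le> 1"
      by (rule card_graph_components_conn)
    also have "1 \<le> card (graph_components G)"
      using V by (intro card_graph_components_pos) auto
    finally show ?thesis by (simp add: non_separating_def)
  qed
  ultimately show "peripheral_cycle G ?c"
    unfolding peripheral_cycle_def induced_cycle_def by blast
qed

lemma path_edges_contract:
  assumes "path_edges xs \<subseteq> E" "u \<notin> set xs"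
  shows "path_edges xs \<subseteq> contract_edges E u v"
  using assms path_edges_subset[of _ xs] by (fastforce simp: contract_edges_def)

text \<open>Identifying the first inner vertex with the third turns the edge \<open>{x, a}\<close>
  into \<open>{z, a}\<close>. The path bypasses \<open>w\<close>, which becomes a pendant vertex at
  \<open>z\<close>, and it keeps the inner vertex \<open>z\<close>.\<close>

lemma theta_contract_long:
  assumes "theta_graph G a b (x # w # z # P) Q R" "bipartition G X Y"
  shows "admissible G x z" "has_K23 (edges (contract G x z))"
proof -
  let ?P = "x # w # z # P"
  have d: "distinct (a # b # ?P @ Q @ R)" and ne: "Q \<noteq> []" "R \<noteq> []"
    and V: "verts G = set (a # b # ?P @ Q @ R)"
    and E: "edges G = path_edges (a # ?P @ [b]) \<union> path_edges (a # Q @ [b]) \<union> path_edges (a # R @ [b])"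
    using assms(1) by (auto simp: theta_graph_def)
  have e: "{x, w} \<in> path_edges (a # ?P @ [b])" "{w, z} \<in> path_edges (a # ?P @ [b])"
    "{x, a} \<in> path_edges (a # ?P @ [b])" by (auto simp: insert_commute)
  then have eG: "{x, w} \<in> edges G" "{w, z} \<in> edges G" "{x, a} \<in> edges G" using E by auto
  have "x \<in> X \<longleftrightarrow> z \<in> X" using bipartition_edge[OF assms(2)] eG by metis
  moreover have "bipartition G Y X" using assms(2) by (rule bipartition_swap)
  moreover have "x \<in> X \<union> Y" "z \<in> X \<union> Y" using assms(2) V by (auto simp: bipartition_def)
  ultimately have "\<exists>X Y. bipartition G X Y \<and> x \<in> X \<and> z \<in> X" using assms(2) by blast
  then show "admissible G x z"
    unfolding admissible_def
    using theta_peripheral[OF assms(1)] e eG d by auto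
  let ?H = "contract_edges (edges G) x z"
  have nx: "x \<notin> set (z # P @ [b])" "x \<notin> set (a # Q @ [b])" "x \<notin> set (a # R @ [b])" using d by auto
  have sub: "path_edges (z # P @ [b]) \<subseteq> edges G" "path_edges (a # Q @ [b]) \<subseteq> edges G"
    "path_edges (a # R @ [b]) \<subseteq> edges G" unfolding E by auto
  note pe = sub(1)[THEN path_edges_contract[OF _ nx(1)], of z] sub(2)[THEN path_edges_contract[OF _ nx(2)], of z]
    sub(3)[THEN path_edges_contract[OF _ nx(3)], of z]
  have az: "{a, z} \<in> ?H" using eG(3) by (auto simp: contract_edges_def insert_commute)
  have "K23_model ?H {a} {b} (set (z # P)) (set Q) (set R)"
  proof (rule K23_modelI)
    have "path_edges (z # P) \<subseteq> ?H" "{last (z # P), b} \<in> ?H"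
      using pe(1) path_edges_append_single[of "z # P" b] by auto
    then show "conn ?H (set (z # P))" by (intro conn_path)
    have "last (z # P) \<in> set (z # P)" by (intro last_in_set) simp
    then show "touch ?H {b} (set (z # P))"
      using \<open>{last (z # P), b} \<in> ?H\<close> unfolding touch_def by (metis insert_commute singletonI)
    show "touch ?H {a} (set (z # P))" using az by (auto simp: touch_def)
    show "conn ?H (set Q)" "touch ?H {a} (set Q)" "touch ?H {b} (set Q)"
      "conn ?H (set R)" "touch ?H {a} (set R)" "touch ?H {b} (set R)"
      using pe(2,3) ne hd_in_set[OF ne(1)] last_in_set[OF ne(1)] hd_in_set[OF ne(2)] last_in_set[OF ne(2)]
      by (auto simp: touch_def insert_commute path_edges_Cons_snoc intro: conn_path)
  qed (use d ne in auto)
  then have "has_K23 ?H" by (rule has_K23I)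
  then show "has_K23 (edges (contract G x z))" by (simp add: contract_def contract_edges_def)
qed

text \<open>Identifying the neighbours of \<open>a\<close> on two of the paths moves the branch
  vertex from \<open>a\<close> to \<open>y\<close>. Both paths lose their first inner vertex but
  still have another one, and \<open>a\<close> becomes an inner vertex of the third path.\<close>

lemma theta_contract_short:
  assumes "theta_graph G a b (x # P) (y # Q) R" "P \<noteq> []" "Q \<noteq> []" "bipartition G X Y"
  shows "admissible G x y" "has_K23 (edges (contract G x y))"
proof -
  have d: "distinct (a # b # (x # P) @ (y # Q) @ R)" and ne: "R \<noteq> []"
    and V: "verts G = set (a # b # (x # P) @ (y # Q) @ R)"
    and E: "edges G = path_edges (a # (x # P) @ [b]) \<union> path_edges (a # (y # Q) @ [b]) \<union> path_edges (a # R @ [b])"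
    using assms(1) by (auto simp: theta_graph_def)
  have e: "{x, a} \<in> path_edges (a # (x # P) @ [b])" "{a, y} \<in> path_edges (a # (y # Q) @ [b])"
    by (auto simp: insert_commute)
  then have eG: "{x, a} \<in> edges G" "{a, y} \<in> edges G" using E by auto
  have "x \<in> X \<longleftrightarrow> y \<in> X" using bipartition_edge[OF assms(4)] eG by metis
  moreover have "bipartition G Y X" using assms(4) by (rule bipartition_swap)
  moreover have "x \<in> X \<union> Y" "y \<in> X \<union> Y" using assms(4) V by (auto simp: bipartition_def)
  ultimately have "\<exists>X Y. bipartition G X Y \<and> x \<in> X \<and> y \<in> X" using assms(4) by blast
  then show "admissible G x y"
    unfolding admissible_def
    using theta_peripheral[OF assms(1)] e eG d by auto
  let ?H = "contract_edges (edges G) x y"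
  have nx: "x \<notin> set (P @ [b])" "x \<notin> set (a # y # Q @ [b])" "x \<notin> set (a # R @ [b])" using d by auto
  have sub: "path_edges (P @ [b]) \<subseteq> edges G" "path_edges (a # y # Q @ [b]) \<subseteq> edges G"
    "path_edges (a # R @ [b]) \<subseteq> edges G" and "{x, hd P} \<in> edges G"
    unfolding E using assms(2) by (auto simp: path_edges_Cons)
  note pe = sub(1)[THEN path_edges_contract[OF _ nx(1)], of y] sub(2)[THEN path_edges_contract[OF _ nx(2)], of y]
    sub(3)[THEN path_edges_contract[OF _ nx(3)], of y]
  have yP: "{y, hd P} \<in> ?H" using \<open>{x, hd P} \<in> edges G\<close> by (auto simp: contract_edges_def)
  have P: "path_edges P \<subseteq> ?H" "{last P, b} \<in> ?H" "hd P \<in> set P" "last P \<in> set P"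
    using pe(1) assms(2) by (auto simp: path_edges_append_single)
  have Q: "path_edges Q \<subseteq> ?H" "{last Q, b} \<in> ?H" "hd Q \<in> set Q" "last Q \<in> set Q" "{y, hd Q} \<in> ?H" "{a, y} \<in> ?H"
    using pe(2) assms(3) by (auto simp: path_edges_append_single path_edges_Cons)
  have R: "path_edges (a # R) \<subseteq> ?H" "{last R, b} \<in> ?H" "last R \<in> set R"
    using pe(3) ne path_edges_append_single[of "a # R" b] by auto
  have "K23_model ?H {y} {b} (set P) (set Q) (set (a # R))"
  proof (rule K23_modelI)
    show "conn ?H (set P)" "conn ?H (set Q)" "conn ?H (set (a # R))" using P Q R conn_path by blast+
    show "touch ?H {y} (set P)" "touch ?H {y} (set Q)" "touch ?H {b} (set P)" "touch ?H {b} (set Q)"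
      "touch ?H {y} (set (a # R))" "touch ?H {b} (set (a # R))"
      using P Q R yP by (auto simp: touch_def insert_commute)
  qed (use d ne assms in auto)
  then have "has_K23 ?H" by (rule has_K23I)
  then show "has_K23 (edges (contract G x y))" by (simp add: contract_def contract_edges_def)
qed

lemma theta_graph_K23:
  assumes "theta_graph G a b [x] [y] [z]"
  shows "isomorphic G (complete_bipartite 2 3)"
proof -
  have d: "distinct [a, b, x, y, z]" and V: "verts G = {a, b, x, y, z}"
    and E: "edges G = {{a, x}, {x, b}, {a, y}, {y, b}, {a, z}, {z, b}}"
    using assms by (auto simp: theta_graph_def)
  define f :: "'a \<Rightarrow> nat + nat" where
    "f t = (if t = a then Inl 0 else if t = b then Inl 1 else if t = x then Inr 0 else if t = y then Inr 1 else Inr 2)" for t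
  have f: "f a = Inl 0" "f b = Inl 1" "f x = Inr 0" "f y = Inr 1" "f z = Inr 2"
    using d by (auto simp: f_def)
  have K: "verts (complete_bipartite 2 3) = {Inl 0, Inl 1, Inr 0, Inr 1, Inr 2}"
    by (auto simp: complete_bipartite_def)
  have KE: "{Inl i, Inr j} \<in> edges (complete_bipartite 2 3) \<longleftrightarrow> i < 2 \<and> j < 3"
    "{Inr j, Inl i} \<in> edges (complete_bipartite 2 3) \<longleftrightarrow> i < 2 \<and> j < 3"
    "{Inl i, Inl i'} \<notin> edges (complete_bipartite 2 3)" "{Inr j, Inr j'} \<notin> edges (complete_bipartite 2 3)" for i i' j j'
    by (auto simp: complete_bipartite_def doubleton_eq_iff)
  have KL: "{Inl i} \<notin> edges (complete_bipartite 2 3)" "{Inr j} \<notin> edges (complete_bipartite 2 3)" for i j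
    using KE(3)[of i i] KE(4)[of j j] by auto
  have d': "a \<noteq> b" "b \<noteq> a" "a \<noteq> x" "x \<noteq> a" "a \<noteq> y" "y \<noteq> a" "a \<noteq> z" "z \<noteq> a" "b \<noteq> x" "x \<noteq> b" "b \<noteq> y" "y \<noteq> b"
    "b \<noteq> z" "z \<noteq> b" "x \<noteq> y" "y \<noteq> x" "x \<noteq> z" "z \<noteq> x" "y \<noteq> z" "z \<noteq> y" using d by auto
  have "bij_betw f (verts G) (verts (complete_bipartite 2 3))"
    unfolding V K bij_betw_def using f by (auto simp: inj_on_def)
  moreover have "\<forall>s\<in>verts G. \<forall>t\<in>verts G. {s, t} \<in> edges G \<longleftrightarrow> {f s, f t} \<in> edges (complete_bipartite 2 3)"
    unfolding V by (simp add: f KE KL d' E doubleton_eq_iff flip: One_nat_def)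
  ultimately show ?thesis unfolding isomorphic_def by blast
qed

text \<open>If neither contraction applies, no path has three inner vertices and at most one has
  two. A path with two inner vertices next to one with a single inner vertex would close an odd
  cycle, so every path has exactly one.\<close>

lemma theta_reduce:
  assumes "theta_graph G a b P Q R" "simple_graph G" "bipartite G"
  shows "isomorphic G (complete_bipartite 2 3) \<or>
    (\<exists>u v. admissible G u v \<and> has_K23 (edges (contract G u v)))"
proof -
  obtain X Y where bip: "bipartition G X Y" using assms by (auto simp: bipartite_def)
  have perm: "theta_graph G a b Q P R" "theta_graph G a b R P Q" "theta_graph G a b P R Q"
    "theta_graph G a b Q R P" "theta_graph G a b R Q P"
    using assms(1) theta_graph_perm1 theta_graph_perm2 by metis+
  have long: ?thesis if th: "theta_graph G a b S T U" and S3: "length S \<ge> 3" for S T U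
  proof -
    obtain x w z S' where S: "S = x # w # z # S'"
      using S3 by (metis Suc_le_length_iff numeral_3_eq_3)
    show ?thesis using theta_contract_long[OF th[unfolded S] bip] by blast
  qed
  have short: ?thesis if th: "theta_graph G a b S T U" and S2: "length S \<ge> 2" and T2: "length T \<ge> 2" for S T U
  proof -
    obtain x S' where S: "S = x # S'" "S' \<noteq> []" using S2 by (cases S) force+
    obtain y T' where T: "T = y # T'" "T' \<noteq> []" using T2 by (cases T) force+
    show ?thesis using theta_contract_short[OF th[unfolded S(1) T(1)] S(2) T(2) bip] by blast
  qed
  have mixed: False if th: "theta_graph G a b S T U" and S2: "length S = 2" and T1: "length T = 1" for S T U
  proof -
    obtain x x' y where S: "S = [x, x']" "T = [y]"
      using S2 T1 by (auto simp: length_Suc_conv numeral_2_eq_2)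
    have "{a, x} \<in> edges G" "{x, x'} \<in> edges G" "{x', b} \<in> edges G" "{a, y} \<in> edges G" "{y, b} \<in> edges G"
      using th unfolding S by (auto simp: theta_graph_def)
    then show False using bipartition_edge[OF bip] by metis
  qed
  have one: "\<exists>x. S = [x]" if "length S = 1" for S :: "'a list" using that by (auto simp: length_Suc_conv)
  have ne: "P \<noteq> []" "Q \<noteq> []" "R \<noteq> []" using assms(1) by (auto simp: theta_graph_def)
  then have len: "length P \<ge> 1" "length Q \<ge> 1" "length R \<ge> 1" by (simp_all add: Suc_le_eq)
  consider "length P \<ge> 3 \<or> length Q \<ge> 3 \<or> length R \<ge> 3"
    | "length P \<ge> 2 \<and> length Q \<ge> 2 \<or> length P \<ge> 2 \<and> length R \<ge> 2 \<or> length Q \<ge> 2 \<and> length R \<ge> 2"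
    | "length P = 2 \<and> length Q = 1 \<or> length Q = 2 \<and> length P = 1 \<or> length R = 2 \<and> length P = 1"
    | "length P = 1" "length Q = 1" "length R = 1"
    using len by linarith
  then show ?thesis
  proof cases
    case 1 then show ?thesis using long perm assms(1) by blast
  next
    case 2 then show ?thesis using short perm assms(1) by blast
  next
    case 3 then show ?thesis using mixed perm assms(1) by blast
  next
    case 4 then show ?thesis using one theta_graph_K23 assms(1) by metis
  qed
qed

text \<open>Passing to a theta subgraph first makes an admissible contraction available. The
  contraction removes a vertex, so the induction hypothesis applies to its result, whatever else has
  become of the theta graph.\<close>

lemma has_K23_imp_bipartite_minor:
  assumes "simple_graph G" "bipartite G" "has_K23 (edges G)"
  shows "bipartite_minor (complete_bipartite 2 3) G"
  using assms
proof (induction "card (verts G)" arbitrary: G rule: less_induct)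
  case less
  obtain T a b P Q R where T: "theta_graph T a b P Q R" "verts T \<subseteq> verts G" "edges T \<subseteq> edges G"
    "\<Union>(edges T) \<subseteq> verts T"
    using obtain_theta_subgraph[OF less.prems(1,3)] by blast
  have eq: "\<lparr>verts = verts T, edges = edges T\<rparr> = T" by simp
  have GT: "bipartite_minor_step\<^sup>*\<^sup>* G T"
    using minor_steps_subgraph[OF less.prems(1) T(2-4)] unfolding eq .
  have sT: "simple_graph T" "bipartite T"
    using simple_graph_subgraph[OF less.prems(1) T(2-4)] bipartite_subgraph[OF less.prems(2) T(2-4)] unfolding eq .
  from theta_reduce[OF T(1) sT] show ?case
  proof
    assume "isomorphic T (complete_bipartite 2 3)"
    then show ?thesis using GT by (auto simp: bipartite_minor_def)
  next
    assume "\<exists>u v. admissible T u v \<and> has_K23 (edges (contract T u v))"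
    then obtain u v where uv: "admissible T u v" "has_K23 (edges (contract T u v))" by blast
    let ?H = "contract T u v"
    have st: "bipartite_minor_step T ?H" using uv by (intro bipartite_minor_step.contraction)
    then have H: "simple_graph ?H" "bipartite ?H" using minor_step_invariants sT by blast+
    have "u \<in> verts T" using uv(1) by (auto simp: admissible_def bipartition_def)
    then have "card (verts ?H) < card (verts T)"
      using card_Diff1_less[of "verts T" u] sT(1) by (simp add: contract_def simple_graph_def)
    also have "\<dots> \<le> card (verts G)" using T(2) less.prems(1) by (intro card_mono) (auto simp: simple_graph_def)
    finally have "bipartite_minor (complete_bipartite 2 3) ?H" using less.hyps H uv(2) by blast
    then obtain H' where "bipartite_minor_step\<^sup>*\<^sup>* ?H H'" "isomorphic H' (complete_bipartite 2 3)"
      by (auto simp: bipartite_minor_def)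
    moreover have "bipartite_minor_step\<^sup>*\<^sup>* G ?H" using GT st by (rule rtranclp.rtrancl_into_rtrancl)
    ultimately show ?thesis unfolding bipartite_minor_def by (meson rtranclp_trans)
  qed
qed

section \<open>Noncrossing cyclic orderings\<close>

text \<open>The condition for a one-page book embedding with spine order \<open>xs\<close>. Although
  stated with linear positions, it depends only on the cyclic order.\<close>

definition noncrossing :: "'a set set \<Rightarrow> 'a list \<Rightarrow> bool" where
  "noncrossing E xs \<longleftrightarrow> (\<forall>i j k l. i < j \<longrightarrow> j < k \<longrightarrow> k < l \<longrightarrow> l < length xs \<longrightarrow>
     \<not> ({xs ! i, xs ! k} \<in> E \<and> {xs ! j, xs ! l} \<in> E))"

lemma noncrossingD:
  "noncrossing E xs \<Longrightarrow> i < j \<Longrightarrow> j < k \<Longrightarrow> k < l \<Longrightarrow> l < length xs \<Longrightarrow>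
   {xs ! i, xs ! k} \<in> E \<Longrightarrow> {xs ! j, xs ! l} \<in> E \<Longrightarrow> False"
  unfolding noncrossing_def by blast

lemma noncrossing_rotate1:
  assumes "noncrossing E xs"
  shows "noncrossing E (rotate1 xs)"
proof (cases xs)
  case (Cons x ys)
  show ?thesis
    unfolding noncrossing_def
  proof (intro allI impI notI)
    fix i j k l
    assume lt: "i < j" "j < k" "k < l" "l < length (rotate1 xs)"
      and e: "{rotate1 xs ! i, rotate1 xs ! k} \<in> E \<and> {rotate1 xs ! j, rotate1 xs ! l} \<in> E"
    have s: "rotate1 xs ! t = xs ! Suc t" if "t < length ys" for t
      using Cons that by (simp add: nth_append)
    have l: "rotate1 xs ! length ys = xs ! 0" using Cons by simp
    show False
    proof (cases "l = length ys")
      \<comment> \<open>Position \<open>l\<close> now holds the old first vertex. In the old list it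
        precedes the other three, so the two crossing pairs exchange their roles.\<close>
      case True
      then have "{xs ! Suc i, xs ! Suc k} \<in> E" "{xs ! 0, xs ! Suc j} \<in> E"
        using e lt s l by (simp_all add: insert_commute)
      then show False using noncrossingD[OF assms, of 0 "Suc i" "Suc j" "Suc k"] lt True Cons by auto
    next
      case False
      then have "l < length ys" using lt Cons by simp
      then have "{xs ! Suc i, xs ! Suc k} \<in> E" "{xs ! Suc j, xs ! Suc l} \<in> E"
        using e lt s by simp_all
      then show False using noncrossingD[OF assms, of "Suc i" "Suc j" "Suc k" "Suc l"] lt \<open>l < length ys\<close> Cons by auto
    qed
  qed
qed (use assms in simp)

lemma noncrossing_rotate: "noncrossing E xs \<Longrightarrow> noncrossing E (rotate n xs)"
  by (induction n) (simp_all add: rotate_def noncrossing_rotate1)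

lemma noncrossing_short: "length xs \<le> 3 \<Longrightarrow> noncrossing E xs"
  unfolding noncrossing_def by auto

text \<open>\<open>vs\<close> is empty or holds the one vertex shared by the two pieces. With no
  edge between \<open>xs\<close> and \<open>ys\<close>, a crossing that reaches into
  \<open>ys\<close> has all its other ends in \<open>vs @ ys\<close>, so it occurs already
  there.\<close>

lemma noncrossing_append:
  assumes "noncrossing E (vs @ xs)" "noncrossing E (vs @ ys)" "length vs \<le> 1"
    and no: "\<And>x y. x \<in> set xs \<Longrightarrow> y \<in> set ys \<Longrightarrow> {x, y} \<notin> E"
  shows "noncrossing E (vs @ xs @ ys)"
  unfolding noncrossing_def
proof (intro allI impI notI)
  let ?zs = "vs @ xs @ ys"
  let ?m = "length (vs @ xs)"
  fix i j k l
  assume lt: "i < j" "j < k" "k < l" "l < length ?zs"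
    and e: "{?zs ! i, ?zs ! k} \<in> E \<and> {?zs ! j, ?zs ! l} \<in> E"
  have early: "?zs ! t = (vs @ xs) ! t" if "t < ?m" for t
    using that nth_append[of "vs @ xs" ys t] by simp
  have late: "?zs ! t = (vs @ ys) ! (t - length xs)" if "t \<ge> ?m" for t
    using that by (auto simp: nth_append add.commute)
  have v: "?zs ! t = (vs @ ys) ! t" if "t < length vs" for t using that by (simp add: nth_append)
  have x: "?zs ! t \<in> set xs" if "t \<ge> length vs" "t < ?m" for t
    using early[OF that(2)] that by (simp add: nth_append)
  have y: "?zs ! t \<in> set ys" if "t \<ge> ?m" "t < length ?zs" for t
    using that nth_append[of "vs @ xs" ys t] by simp
  show False
  proof (cases "l < ?m")
    case True
    then show False using noncrossingD[OF assms(1) lt(1-3)] lt e early by simp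
  next
    case False
    have j: "j \<ge> ?m"
    proof (rule ccontr)
      assume "\<not> j \<ge> ?m"
      \<comment> \<open>From \<open>i < j\<close> the index \<open>j\<close> is at least 1, so it
        lies beyond \<open>vs\<close>, which has at most one entry.\<close>
      then have "?zs ! j \<in> set xs" using lt(1) assms(3) by (intro x) auto
      moreover have "?zs ! l \<in> set ys" using False lt by (intro y) auto
      ultimately show False using no e by blast
    qed
    show False
    proof (cases "i \<ge> ?m")
      case True
      have "{(vs @ ys) ! (i - length xs), (vs @ ys) ! (k - length xs)} \<in> E"
        "{(vs @ ys) ! (j - length xs), (vs @ ys) ! (l - length xs)} \<in> E"
        using e True lt late by simp_all
      moreover have "i - length xs < j - length xs" "j - length xs < k - length xs"
        "k - length xs < l - length xs" "l - length xs < length (vs @ ys)"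
        using lt True unfolding length_append by linarith+
      ultimately show False using noncrossingD[OF assms(2)] by blast
    next
      case i: False
      have iv: "i < length vs"
      proof (rule ccontr)
        assume "\<not> i < length vs"
        then have "?zs ! i \<in> set xs" using i by (intro x) auto
        moreover have "?zs ! k \<in> set ys" using j lt by (intro y) auto
        ultimately show False using no e by blast
      qed
      have "{(vs @ ys) ! i, (vs @ ys) ! (k - length xs)} \<in> E"
        "{(vs @ ys) ! (j - length xs), (vs @ ys) ! (l - length xs)} \<in> E"
        using e j lt late v[OF iv] by simp_all
      moreover have "i < j - length xs" "j - length xs < k - length xs"
        "k - length xs < l - length xs" "l - length xs < length (vs @ ys)"
        using lt j iv unfolding length_append by linarith+
      ultimately show False using noncrossingD[OF assms(2)] by blast
    qed
  qed
qed

definition ordering :: "'a set set \<Rightarrow> 'a set \<Rightarrow> 'a list \<Rightarrow> bool" where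
  "ordering E V xs \<longleftrightarrow> distinct xs \<and> set xs = V \<and> noncrossing E xs"

lemma ordering_rooted:
  assumes "ordering E V xs" "v \<in> V"
  obtains ys where "ordering E V (v # ys)"
proof -
  obtain n ys where "rotate n xs = v # ys"
    using assms rotate_to_front[of v xs] by (auto simp: ordering_def)
  moreover have "ordering E V (rotate n xs)"
    using assms(1) by (auto simp: ordering_def noncrossing_rotate)
  ultimately show ?thesis using that by metis
qed

text \<open>Disjoint pieces are concatenated. Pieces with a common vertex are first rotated so that
  both orderings begin with it, and one copy of it is dropped.\<close>

lemma ordering_glue:
  assumes "ordering E V1 xs1" "ordering E V2 xs2" "card (V1 \<inter> V2) \<le> 1"
    and no: "\<And>x y. x \<in> V1 - V2 \<Longrightarrow> y \<in> V2 - V1 \<Longrightarrow> {x, y} \<notin> E"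
  shows "\<exists>xs. ordering E (V1 \<union> V2) xs"
proof -
  have "finite (V1 \<inter> V2)" using assms(1) by (auto simp: ordering_def)
  then consider "V1 \<inter> V2 = {}" | v where "V1 \<inter> V2 = {v}"
    using assms(3) by (metis One_nat_def card_0_eq card_1_singletonE le_Suc_eq le_zero_eq)
  then show ?thesis
  proof cases
    case 1
    then have "ordering E (V1 \<union> V2) ([] @ xs1 @ xs2)"
      using assms noncrossing_append[of E "[]" xs1 xs2] by (auto simp: ordering_def)
    then show ?thesis by blast
  next
    case 2
    obtain ys1 where y1: "ordering E V1 (v # ys1)" using ordering_rooted[OF assms(1), of v] 2 by blast
    obtain ys2 where y2: "ordering E V2 (v # ys2)" using ordering_rooted[OF assms(2), of v] 2 by blast
    have s: "set ys1 = V1 - V2" "set ys2 = V2 - V1"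
      using y1 y2 2 by (auto simp: ordering_def)
    have "noncrossing E ([v] @ ys1 @ ys2)"
      using y1 y2 no s by (intro noncrossing_append) (auto simp: ordering_def)
    moreover have "set ([v] @ ys1 @ ys2) = V1 \<union> V2" using s 2 by auto
    moreover have "distinct ([v] @ ys1 @ ys2)" using y1 y2 s by (auto simp: ordering_def)
    ultimately show ?thesis unfolding ordering_def by blast
  qed
qed

section \<open>Longest cycles in pieces without small separations\<close>

definition cycle_in :: "'a set set \<Rightarrow> 'a set \<Rightarrow> 'a list \<Rightarrow> bool" where
  "cycle_in E V c \<longleftrightarrow> length c \<ge> 3 \<and> distinct c \<and> set c \<subseteq> V \<and> cycle_edges c \<subseteq> E"

lemma cycle_in_rotate: "cycle_in E V c \<Longrightarrow> cycle_in E V (rotate n c)"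
  by (simp add: cycle_in_def cycle_edges_rotate)

text \<open>The closing edge from \<open>y\<close> back to \<open>x\<close> is replaced by a path
  through \<open>K\<close>.\<close>

lemma cycle_in_extend:
  assumes "cycle_in E V (x # R @ [y])" "conn E K" "touch E {x} K" "touch E {y} K" "K \<subseteq> V"
    "set (x # R @ [y]) \<inter> K = {}"
  obtains c where "cycle_in E V c" "length c > length (x # R @ [y])"
proof -
  obtain P where P: "P \<noteq> []" "distinct P" "set P \<subseteq> K" "path_edges (y # P @ [x]) \<subseteq> E"
    using path_edges_snoc_edges[OF assms(2,4,3)] .
  let ?c = "x # R @ y # P"
  have "cycle_edges (x # R @ [y]) = path_edges ((x # R) @ [y, x])" by (simp add: cycle_edges_eq)
  also have "\<dots> = insert {last (x # R), y} (path_edges (x # R) \<union> path_edges [y, x])"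
    by (subst path_edges_append) auto
  finally have "insert {last (x # R), y} (path_edges (x # R)) \<subseteq> E"
    using assms(1) unfolding cycle_in_def by blast
  moreover have "cycle_edges ?c = path_edges ((x # R) @ (y # P @ [x]))" by (simp add: cycle_edges_eq)
  moreover have "path_edges ((x # R) @ (y # P @ [x])) = insert {last (x # R), y} (path_edges (x # R) \<union> path_edges (y # P @ [x]))"
    by (subst path_edges_append) auto
  ultimately have "cycle_edges ?c \<subseteq> E" using P(4) by simp
  then have "cycle_in E V ?c"
    using assms(1,5,6) P by (auto simp: cycle_in_def)
  then show ?thesis using that P(1) by simp
qed

text \<open>On at least three vertices this is 2-connectedness of the subgraph induced by
  \<open>V\<close>. It is phrased by separations so that its failure is directly the input of
  \<open>ordering_glue\<close>.\<close>

definition no_small_separation :: "'a set set \<Rightarrow> 'a set \<Rightarrow> bool" where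
  "no_small_separation E V \<longleftrightarrow> (\<forall>V1 V2. V1 \<union> V2 = V \<longrightarrow> V1 \<noteq> V \<longrightarrow> V2 \<noteq> V \<longrightarrow> card (V1 \<inter> V2) \<le> 1 \<longrightarrow>
     (\<exists>x\<in>V1 - V2. \<exists>y\<in>V2 - V1. {x, y} \<in> E))"

lemma no_small_separationD:
  assumes "no_small_separation E V" "V1 \<union> V2 = V" "V1 \<noteq> V" "V2 \<noteq> V" "card (V1 \<inter> V2) \<le> 1"
  obtains x y where "x \<in> V1 - V2" "y \<in> V2 - V1" "{x, y} \<in> E"
  using assms unfolding no_small_separation_def by blast

lemma card_gt_one_obtain:
  assumes "\<not> card N \<le> 1"
  obtains x y where "x \<in> N" "y \<in> N" "x \<noteq> y"
proof -
  have "\<not> is_singleton N" "N \<noteq> {}" using assms by (auto simp: is_singleton_altdef)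
  then show ?thesis using that by (metis is_singletonI' ex_in_conv)
qed

text \<open>A vertex \<open>v\<close> has two neighbours, since otherwise its neighbourhood
  \<open>N\<close> would separate it from the rest. These are joined by a path that avoids
  \<open>v\<close>, since otherwise \<open>v\<close> would be a cut vertex; closing the path through
  \<open>v\<close> gives the cycle.\<close>

lemma no_small_separation_cycle:
  assumes sep: "no_small_separation E V" and V: "finite V" "card V \<ge> 3"
  obtains c where "cycle_in E V c"
proof -
  obtain v where v: "v \<in> V" using V by fastforce
  define N where "N = {y \<in> V - {v}. {v, y} \<in> E}"
  have "\<not> card N \<le> 1"
  proof
    assume N: "card N \<le> 1"
    have "finite N" using V by (simp add: N_def)
    then have "card (insert v N) \<le> 2" using N by (simp add: card_insert_if)
    then have 1: "insert v N \<noteq> V" using V by auto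
    have 2: "insert v N \<inter> (V - {v}) = N" by (auto simp: N_def)
    have 3: "insert v N \<union> (V - {v}) = V" using v by (auto simp: N_def)
    obtain x y where "x \<in> insert v N - (V - {v})" "y \<in> (V - {v}) - insert v N" "{x, y} \<in> E"
      using no_small_separationD[OF sep 3 1] N 2 v by auto
    then show False by (auto simp: N_def)
  qed
  then obtain x y where xy: "x \<in> N" "y \<in> N" "x \<noteq> y" by (rule card_gt_one_obtain)
  let ?K = "component_in E (V - {v}) x"
  have KS: "?K \<subseteq> V - {v}" using xy by (intro component_in_subset) (auto simp: N_def)
  have xK: "x \<in> ?K" by (rule component_in_self)
  have yK: "y \<in> ?K"
  proof (rule ccontr)
    assume y: "y \<notin> ?K"
    have 1: "insert v ?K \<noteq> V" "V - ?K \<noteq> V" using xy y xK KS by (auto simp: N_def)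
    have 2: "insert v ?K \<inter> (V - ?K) = {v}" using v KS by auto
    have 3: "insert v ?K \<union> (V - ?K) = V" using v KS by auto
    obtain p q where pq: "p \<in> insert v ?K - (V - ?K)" "q \<in> V - ?K - insert v ?K" "{p, q} \<in> E"
      using no_small_separationD[OF sep 3 1] 2 by auto
    then have "p \<in> ?K" "q \<in> V - {v}" "q \<notin> ?K" using v by auto
    then show False using component_in_closed[of p E "V - {v}" x q] pq(3) KS by blast
  qed
  obtain P where P: "P \<noteq> []" "hd P = x" "last P = y" "distinct P" "set P \<subseteq> ?K" "path_edges P \<subseteq> E"
    using conn_obtain_path[OF conn_component_in xK yK] .
  have "length P \<ge> 2" using P xy by (cases P) (auto simp: Suc_le_eq split: if_splits)
  moreover have "cycle_edges (v # P) \<subseteq> E"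
    using P xy by (auto simp: cycle_edges_eq path_edges_Cons_snoc N_def insert_commute)
  ultimately have "cycle_in E V (v # P)" using P KS v by (auto simp: cycle_in_def)
  then show ?thesis by (rule that)
qed

text \<open>A component \<open>?K\<close> off the cycle has at least two attachments, as the set
  \<open>N\<close> of attachments separates it from the rest of the cycle. Two attachments that are
  consecutive on the cycle allow a detour through \<open>?K\<close>, contradicting maximality. If
  they are not consecutive, the two arcs between them and \<open>?K\<close> form the side of size
  three of a K_{2,3} model.\<close>

lemma longest_cycle_Hamiltonian:
  assumes sep: "no_small_separation E V" and V: "finite V" and noK: "\<not> has_K23 E"
    and c: "cycle_in E V c" and max: "\<And>d. cycle_in E V d \<Longrightarrow> length d \<le> length c"
  shows "set c = V"
proof (rule ccontr)
  assume "set c \<noteq> V"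
  moreover have cV: "set c \<subseteq> V" "distinct c" "length c \<ge> 3" using c by (auto simp: cycle_in_def)
  ultimately obtain s where s: "s \<in> V - set c" by blast
  let ?K = "component_in E (V - set c) s"
  have sK: "s \<in> ?K" by (rule component_in_self)
  have KS: "?K \<subseteq> V - set c" using s by (intro component_in_subset)
  define N where "N = {x \<in> set c. touch E {x} ?K}"
  have "\<not> card N \<le> 1"
  proof
    assume N: "card N \<le> 1"
    have "card (set c) \<ge> 3" using cV by (simp add: distinct_card)
    then have "\<not> set c \<subseteq> N" using N card_mono[of N "set c"] by (auto simp: N_def)
    then have 1: "?K \<union> N \<noteq> V" using cV KS by auto
    have 2: "V - ?K \<noteq> V" using sK KS by auto
    have 3: "(?K \<union> N) \<union> (V - ?K) = V" using KS cV by (auto simp: N_def)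
    have 4: "(?K \<union> N) \<inter> (V - ?K) = N" using KS cV by (auto simp: N_def)
    obtain p q where pq: "p \<in> (?K \<union> N) - (V - ?K)" "q \<in> V - ?K - (?K \<union> N)" "{p, q} \<in> E"
      using no_small_separationD[OF sep 3 1 2] 4 N by auto
    then have p: "p \<in> ?K" and q: "q \<in> V" "q \<notin> ?K" "q \<notin> N" using cV by (auto simp: N_def)
    have "q \<notin> set c"
      using p q pq(3) by (auto simp: N_def touch_def insert_commute)
    then show False using component_in_closed[OF p, of q] KS p q pq(3) by blast
  qed
  then obtain x y where xy: "x \<in> N" "y \<in> N" "x \<noteq> y" by (rule card_gt_one_obtain)
  have t: "touch E {x} ?K" "touch E {y} ?K" using xy by (auto simp: N_def)
  obtain n cs where rot: "rotate n c = x # cs"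
    using xy rotate_to_front[of x c] by (auto simp: N_def)
  have cx: "cycle_in E V (x # cs)" using cycle_in_rotate[OF c, of n] rot by simp
  have len: "length (x # cs) = length c" using rot length_rotate[of n c] by simp
  have set: "set (x # cs) = set c" using rot set_rotate[of n c] by simp
  then have "y \<in> set cs" using xy by (auto simp: N_def)
  then obtain P Q where cs: "cs = P @ y # Q" by (meson split_list)
  show False
  proof (cases "P \<noteq> [] \<and> Q \<noteq> []")
    case True
    have "cycle_edges (x # cs) = path_edges ((x # P) @ (y # Q @ [x]))"
      by (simp add: cs cycle_edges_eq)
    also have "\<dots> = insert {last (x # P), y} (path_edges (x # P) \<union> path_edges (y # Q @ [x]))"
      by (subst path_edges_append) auto
    finally have "{last P, y} \<in> E" "{x, hd P} \<in> E" "path_edges P \<subseteq> E" "{y, hd Q} \<in> E" "{last Q, x} \<in> E" "path_edges Q \<subseteq> E"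
      using cx True by (auto simp: cycle_in_def path_edges_Cons path_edges_append_single)
    note pe = this hd_in_set[of P] hd_in_set[of Q] last_in_set[of P] last_in_set[of Q]
    have d: "distinct (x # P @ y # Q)" using cx by (simp add: cycle_in_def cs)
    have KP: "?K \<inter> set (x # P @ y # Q) = {}" using KS set cs by auto
    have "K23_model E {x} {y} (set P) (set Q) ?K"
    proof (rule K23_modelI)
      show "conn E (set P)" "conn E (set Q)" using pe conn_path by blast+
      show "conn E ?K" by (rule conn_component_in)
      show "?K \<noteq> {}" using sK by auto
      show "touch E {x} (set P)" "touch E {x} (set Q)" "touch E {y} (set P)" "touch E {y} (set Q)"
        using pe True by (auto simp: touch_def insert_commute)
    qed (use t True d KP in auto)
    then show False using noK has_K23I by blast
  next
    case False
    have "\<exists>d. cycle_in E V d \<and> length d > length c"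
    proof (cases "Q = []")
      case True
      then have cyc: "cycle_in E V (x # P @ [y])" using cx cs by simp
      have "set (x # P @ [y]) \<inter> ?K = {}" using KS set cs True by auto
      then obtain d where "cycle_in E V d" "length d > length (x # P @ [y])"
        using cycle_in_extend[OF cyc conn_component_in t(1) t(2)] KS by blast
      then show ?thesis using len cs True by auto
    next
      \<comment> \<open>Here \<open>P\<close> is empty, so \<open>x\<close> and \<open>y\<close> are
        the first two vertices. One rotation makes them the last and the first, the form expected by
        \<open>cycle_in_extend\<close>.\<close>
      case nQ: False
      then have "rotate 1 (x # cs) = y # Q @ [x]" using cs False by simp
      then have cyc: "cycle_in E V (y # Q @ [x])" using cycle_in_rotate[OF cx, of 1] by simp
      have "set (y # Q @ [x]) \<inter> ?K = {}" using KS set cs by auto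
      then obtain d where "cycle_in E V d" "length d > length (y # Q @ [x])"
        using cycle_in_extend[OF cyc conn_component_in t(2) t(1)] KS by blast
      then show ?thesis using len cs nQ False by auto
    qed
    then show False using max by fastforce
  qed
qed

text \<open>The ends of two crossing chords cut the cycle into four arcs, each beginning with one of
  them. Neighbouring arcs touch along the cycle and opposite arcs touch by a chord, so the arcs form
  a K_4 model; without a K_{2,3} model this leads to a triangle.\<close>

lemma cycle_noncrossing:
  assumes c: "cycle_in E V c" and noK: "\<not> has_K23 E"
    and bip: "\<And>x y. {x, y} \<in> E \<Longrightarrow> x \<in> X \<longleftrightarrow> y \<notin> X"
  shows "noncrossing E c"
  unfolding noncrossing_def
proof (intro allI impI notI)
  fix i j k l
  assume lt: "i < j" "j < k" "k < l" "l < length c"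
    and e: "{c ! i, c ! k} \<in> E \<and> {c ! j, c ! l} \<in> E"
  define P where "P = take i c"
  define A where "A = take (j - i) (drop i c)"
  define B where "B = take (k - j) (drop j c)"
  define C where "C = take (l - k) (drop k c)"
  define D where "D = drop l c"
  have c_eq: "c = P @ A @ B @ C @ D"
  proof -
    have "drop k c = C @ D" using lt append_take_drop_id[of "l - k" "drop k c"] by (simp add: C_def D_def)
    moreover have "drop j c = B @ drop k c" using lt append_take_drop_id[of "k - j" "drop j c"] by (simp add: B_def)
    moreover have "drop i c = A @ drop j c" using lt append_take_drop_id[of "j - i" "drop i c"] by (simp add: A_def)
    ultimately show ?thesis using append_take_drop_id[of i c] by (simp add: P_def)
  qed
  have ne: "A \<noteq> []" "B \<noteq> []" "C \<noteq> []" "D \<noteq> []" using lt by (auto simp: A_def B_def C_def D_def)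
  have hd: "hd A = c ! i" "hd B = c ! j" "hd C = c ! k" "hd D = c ! l"
    using lt by (auto simp: A_def B_def C_def D_def hd_drop_conv_nth)
  \<comment> \<open>The fourth arc runs from position \<open>l\<close> around the end of the list up
    to position \<open>i\<close>; a rotation by \<open>length P\<close> makes it contiguous.\<close>
  let ?D = "D @ P"
  have "rotate (length P) c = A @ B @ C @ ?D"
    using rotate_append[of P "A @ B @ C @ D"] c_eq by simp
  then have cyc: "cycle_in E V (A @ B @ C @ ?D)" using cycle_in_rotate[OF c, of "length P"] by simp
  then have "path_edges (A @ B @ C @ ?D @ [hd A]) \<subseteq> E"
    using ne by (simp add: cycle_in_def cycle_edges_eq)
  moreover have "path_edges (A @ B @ C @ ?D @ [hd A]) =
     insert {last A, hd B} (path_edges A \<union> insert {last B, hd C} (path_edges B \<union>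
     insert {last C, hd D} (path_edges C \<union> insert {last ?D, hd A} (path_edges ?D))))"
    using ne path_edges_append[of A "B @ C @ ?D @ [hd A]"] path_edges_append[of B "C @ ?D @ [hd A]"]
      path_edges_append[of C "?D @ [hd A]"] path_edges_append_single[of ?D "hd A"] by simp
  ultimately have pe: "path_edges A \<subseteq> E" "path_edges B \<subseteq> E" "path_edges C \<subseteq> E" "path_edges ?D \<subseteq> E"
    "{last A, hd B} \<in> E" "{last B, hd C} \<in> E" "{last C, hd ?D} \<in> E" "{last ?D, hd A} \<in> E"
    using ne by (auto simp del: last_append)
  have tI: "touch E (set S) (set T)" if "{f S, g T} \<in> E" "f S \<in> set S" "g T \<in> set T" for f g and S T :: "'a list"
    using that unfolding touch_def by blast
  have neD: "?D \<noteq> []" using ne by simp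
  have tch: "touch E (set A) (set B)" "touch E (set B) (set C)" "touch E (set C) (set ?D)" "touch E (set ?D) (set A)"
    using tI[of last _ hd] pe ne neD last_in_set hd_in_set by metis+
  have eh: "{hd A, hd C} \<in> E" "{hd B, hd ?D} \<in> E" using e hd ne by auto
  have tch2: "touch E (set A) (set C)" "touch E (set B) (set ?D)"
    using tI[of hd _ hd] eh ne neD hd_in_set by metis+
  have "conn E (set D \<union> set P)" using conn_path[OF pe(4)] by simp
  then have "K4_model E (set A) (set B) (set C) (set ?D)"
    using tch tch2 pe conn_path ne cyc touch_sym[of E "set ?D" "set A"]
    unfolding K4_model_def branch_sets_def cycle_in_def by auto
  then have "\<exists>a b c d. K4_model E {a} {b} {c} {d}"
    using K4_model_imp_K23_or_singletons[of E] noK by blast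
  then obtain a b c d where "K4_model E {a} {b} {c} {d}" by blast
  then have "{a, b} \<in> E" "{b, c} \<in> E" "{a, c} \<in> E" by (auto simp: K4_model_def touch_def)
  then show False using bip by metis
qed

text \<open>\<open>E\<close> and the 2-colouring \<open>X\<close> stay fixed while \<open>V\<close>
  shrinks, so both hypotheses pass to the pieces of a separation unchanged.\<close>

lemma ex_ordering:
  assumes noK: "\<not> has_K23 E" and bip: "\<And>x y. {x, y} \<in> E \<Longrightarrow> x \<in> X \<longleftrightarrow> y \<notin> X"
    and V: "finite V"
  shows "\<exists>xs. ordering E V xs"
  using V
proof (induction "card V" arbitrary: V rule: less_induct)
  case less
  show ?case
  proof (cases "card V \<le> 3")
    case True
    obtain xs where "distinct xs" "set xs = V" using finite_distinct_list less.prems by blast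
    then have "ordering E V xs" using True distinct_card[of xs] noncrossing_short[of xs E] by (auto simp: ordering_def)
    then show ?thesis by blast
  next
    case big: False
    show ?thesis
    proof (cases "no_small_separation E V")
      case False
      then obtain V1 V2 where s: "V1 \<union> V2 = V" "V1 \<noteq> V" "V2 \<noteq> V" "card (V1 \<inter> V2) \<le> 1"
        "\<And>x y. x \<in> V1 - V2 \<Longrightarrow> y \<in> V2 - V1 \<Longrightarrow> {x, y} \<notin> E"
        unfolding no_small_separation_def by blast
      have "V1 \<subset> V" "V2 \<subset> V" using s by auto
      then have "card V1 < card V" "card V2 < card V" "finite V1" "finite V2"
        using less.prems psubset_card_mono finite_subset by (metis psubset_imp_subset)+
      then obtain xs1 xs2 where "ordering E V1 xs1" "ordering E V2 xs2" using less.hyps by blast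
      then show ?thesis using ordering_glue[OF _ _ s(4,5)] s(1) by metis
    next
      case True
      obtain c0 where c0: "cycle_in E V c0"
        using no_small_separation_cycle[OF True less.prems] big by auto
      have "length d < Suc (card V)" if "cycle_in E V d" for d
        using that less.prems card_mono[of V "set d"] by (auto simp: cycle_in_def distinct_card)
      then obtain c where c: "cycle_in E V c" "\<And>d. cycle_in E V d \<Longrightarrow> length d \<le> length c"
        using ex_has_greatest_nat[of "cycle_in E V" c0 length "Suc (card V)"] c0 by blast
      have "set c = V" using longest_cycle_Hamiltonian[OF True less.prems noK c] by blast
      moreover have "noncrossing E c" using cycle_noncrossing[OF c(1) noK bip] by blast
      moreover have "distinct c" using c by (simp add: cycle_in_def)
      ultimately show ?thesis unfolding ordering_def by blast
    qed
  qed
qed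

section \<open>Theta curves and chords of a parabola\<close>

lemma connected_subset_inside:
  assumes "connected S" "S \<inter> C = {}" "S \<inter> inside C \<noteq> {}"
  shows "S \<subseteq> inside C"
proof
  fix y assume y: "y \<in> S"
  obtain x where x: "x \<in> S" "x \<in> inside C" using assms(3) by blast
  have "connected_component (- C) x y"
    using assms x y unfolding connected_component_def by blast
  then show "y \<in> inside C" using inside_same_component x(2) by metis
qed

text \<open>The arcs are not closed, so their winding numbers need not be integers, but the
  difference is the winding number of the closed curve \<open>g +++ reversepath h\<close>. By the
  Jordan curve theorem this is nonzero inside and zero outside.\<close>

lemma two_arcs_winding:
  fixes g h :: "real \<Rightarrow> complex"
  assumes "arc g" "arc h" "pathstart g = a" "pathfinish g = b" "pathstart h = a" "pathfinish h = b"
    "path_image g \<inter> path_image h \<subseteq> {a, b}"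
  shows "z \<in> inside (path_image g \<union> path_image h) \<Longrightarrow> winding_number g z \<noteq> winding_number h z"
    and "z \<in> outside (path_image g \<union> path_image h) \<Longrightarrow> winding_number g z = winding_number h z"
    and "inside (path_image g \<union> path_image h) \<noteq> {}"
    and "connected (inside (path_image g \<union> path_image h))"
    and "frontier (inside (path_image g \<union> path_image h)) = path_image g \<union> path_image h"
proof -
  let ?c = "g +++ reversepath h"
  have c: "simple_path ?c" "pathfinish ?c = pathstart ?c"
    using assms by (auto intro!: simple_path_join_loop simp: arc_reversepath)
  have im: "path_image ?c = path_image g \<union> path_image h"
    using assms by (simp add: path_image_join)
  have wn: "winding_number ?c z = winding_number g z - winding_number h z"
    if "z \<notin> path_image g \<union> path_image h" for z
    using that assms
    by (subst winding_number_join) (auto simp: winding_number_reversepath arc_imp_path)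
  show "winding_number g z \<noteq> winding_number h z" if z: "z \<in> inside (path_image g \<union> path_image h)"
  proof -
    have "z \<notin> path_image g \<union> path_image h" using z inside_no_overlap by blast
    moreover have "winding_number ?c z \<noteq> 0"
      by (rule simple_closed_path_winding_number_inside[OF c(1)]) (use z im in force)+
    ultimately show ?thesis using wn by force
  qed
  show "winding_number g z = winding_number h z" if z: "z \<in> outside (path_image g \<union> path_image h)"
  proof -
    have "z \<notin> path_image g \<union> path_image h" using z outside_no_overlap by blast
    moreover have "winding_number ?c z = 0"
      using winding_number_zero_in_outside[of ?c z] c z im by (simp add: simple_path_imp_path)
    ultimately show ?thesis using wn by force
  qed
  show "inside (path_image g \<union> path_image h) \<noteq> {}" "connected (inside (path_image g \<union> path_image h))"
    "frontier (inside (path_image g \<union> path_image h)) = path_image g \<union> path_image h"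
    using Jordan_inside_outside[OF c] im by auto
qed

text \<open>The inside of \<open>c1\<close> and \<open>c2\<close> is connected and misses
  \<open>c2\<close> and \<open>c3\<close>, so having one point in the inside of \<open>c2\<close>
  and \<open>c3\<close> it lies there entirely. Its frontier contains \<open>c1\<close>, hence
  \<open>c1\<close> lies in the closure of that inside, and apart from its ends it avoids the
  bounding curve.\<close>

lemma theta_curve_aux:
  fixes c1 c2 c3 :: "real \<Rightarrow> complex"
  assumes arcs: "arc c1" "arc c2" "arc c3"
    and ends: "pathstart c1 = a" "pathfinish c1 = b" "pathstart c2 = a" "pathfinish c2 = b"
      "pathstart c3 = a" "pathfinish c3 = b"
    and int: "path_image c1 \<inter> path_image c2 \<subseteq> {a, b}" "path_image c2 \<inter> path_image c3 \<subseteq> {a, b}"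
    and z: "z \<in> inside (path_image c1 \<union> path_image c2)" "z \<in> inside (path_image c2 \<union> path_image c3)"
    and c3: "inside (path_image c1 \<union> path_image c2) \<inter> path_image c3 = {}"
    and d: "path_image c1 \<inter> path_image c3 \<subseteq> {a, b}"
  shows "path_image c1 - {a, b} \<subseteq> inside (path_image c2 \<union> path_image c3)"
proof -
  let ?I = "inside (path_image c1 \<union> path_image c2)"
  let ?C = "path_image c2 \<union> path_image c3"
  note w = two_arcs_winding[OF arcs(1,2) ends(1-4) int(1)]
  have "?I \<inter> ?C = {}" using c3 inside_no_overlap[of "path_image c1 \<union> path_image c2"] by blast
  then have "?I \<subseteq> inside ?C" using connected_subset_inside[OF w(4)] z by blast
  then have "closure ?I \<subseteq> ?C \<union> inside ?C"
    using closure_mono closure_inside_subset[of ?C] arcs closed_Un closed_arc_image by blast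
  moreover have "path_image c1 \<subseteq> closure ?I" using w(5) by (auto simp: frontier_def)
  ultimately show ?thesis using int(1) d by blast
qed

text \<open>The differences of the winding numbers of the three arcs are nonzero exactly inside the
  respective closed curves, and they sum to zero; so a point inside one of these curves is
  inside exactly one of the other two.\<close>

lemma theta_curve:
  fixes c1 c2 c3 :: "real \<Rightarrow> complex"
  assumes arcs: "arc c1" "arc c2" "arc c3"
    and ends: "pathstart c1 = a" "pathfinish c1 = b" "pathstart c2 = a" "pathfinish c2 = b"
      "pathstart c3 = a" "pathfinish c3 = b"
    and int: "path_image c1 \<inter> path_image c2 \<subseteq> {a, b}" "path_image c2 \<inter> path_image c3 \<subseteq> {a, b}"
      "path_image c1 \<inter> path_image c3 \<subseteq> {a, b}"
  shows "path_image c1 - {a, b} \<subseteq> inside (path_image c2 \<union> path_image c3) \<or>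
    path_image c2 - {a, b} \<subseteq> inside (path_image c1 \<union> path_image c3) \<or>
    path_image c3 - {a, b} \<subseteq> inside (path_image c1 \<union> path_image c2)"
proof (cases "inside (path_image c1 \<union> path_image c2) \<inter> path_image c3 = {}")
  case False
  have ab: "a \<in> path_image c1" "b \<in> path_image c1"
    using ends pathstart_in_path_image pathfinish_in_path_image by metis+
  have con: "connected (path_image c3 - {a, b})"
    using connected_simple_path_endless[OF arc_imp_simple_path[OF arcs(3)]] ends by simp
  have no: "inside (path_image c1 \<union> path_image c2) \<inter> (path_image c1 \<union> path_image c2) = {}"
    by (rule inside_no_overlap)
  have "path_image c3 - {a, b} \<subseteq> inside (path_image c1 \<union> path_image c2)"
  proof (rule connected_subset_inside[OF con])
    show "(path_image c3 - {a, b}) \<inter> (path_image c1 \<union> path_image c2) = {}" using int(2,3) by blast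
    obtain w where w: "w \<in> inside (path_image c1 \<union> path_image c2)" "w \<in> path_image c3" using False by blast
    then have "w \<noteq> a" "w \<noteq> b" using no ab by blast+
    then show "(path_image c3 - {a, b}) \<inter> inside (path_image c1 \<union> path_image c2) \<noteq> {}" using w by blast
  qed
  then show ?thesis by simp
next
  \<comment> \<open>As \<open>c3\<close> does not enter the inside of \<open>c1\<close> and
    \<open>c2\<close>, a point chosen there avoids all three arcs, and its three winding numbers can
    be compared.\<close>
  case True
  note w12 = two_arcs_winding[OF arcs(1,2) ends(1-4) int(1)]
  note w23 = two_arcs_winding[OF arcs(2,3) ends(3-6) int(2)]
  note w13 = two_arcs_winding[OF arcs(1,3) ends(1,2,5,6) int(3)]
  obtain z where z: "z \<in> inside (path_image c1 \<union> path_image c2)" using w12(3) by blast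
  then have nz: "z \<notin> path_image c1 \<union> path_image c2 \<union> path_image c3"
    using True inside_no_overlap[of "path_image c1 \<union> path_image c2"] by blast
  have "z \<in> inside (path_image c2 \<union> path_image c3) \<or> z \<in> inside (path_image c1 \<union> path_image c3)"
  proof (rule ccontr)
    assume "\<not> ?thesis"
    then have "z \<in> outside (path_image c2 \<union> path_image c3)" "z \<in> outside (path_image c1 \<union> path_image c3)"
      using nz inside_Un_outside[of "path_image c2 \<union> path_image c3"]
        inside_Un_outside[of "path_image c1 \<union> path_image c3"] by blast+
    then show False using w12(1)[OF z] w13(2) w23(2) by metis
  qed
  then show ?thesis
  proof
    assume "z \<in> inside (path_image c2 \<union> path_image c3)"
    then show ?thesis using theta_curve_aux[OF arcs ends int(1,2) z _ True int(3)] by blast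
  next
    assume z3: "z \<in> inside (path_image c1 \<union> path_image c3)"
    have "path_image c2 - {a, b} \<subseteq> inside (path_image c1 \<union> path_image c3)"
      using theta_curve_aux[OF arcs(2,1,3) ends(3,4,1,2,5,6), of z] int z z3 True
      by (simp add: Un_commute Int_commute)
    then show ?thesis by simp
  qed
qed

text \<open>Points on a parabola are in convex position, so chords cross only if their ends
  interleave. Moreover every chord lies on or above the curve, which leaves each vertex accessible
  from below, that is, from the outer face.\<close>

definition parab :: "real \<Rightarrow> complex" where
  "parab t = Complex t (t\<^sup>2)"

lemma inj_parab: "parab s = parab t \<longleftrightarrow> s = t"
  by (auto simp: parab_def)

lemma parab_segment:
  assumes "z \<in> path_image (linepath (parab s) (parab t))" "s < t"
  shows "s \<le> Re z" "Re z \<le> t" "Im z = (s + t) * Re z - s * t"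
proof -
  obtain u where u: "0 \<le> u" "u \<le> 1" "z = (1 - u) *\<^sub>R parab s + u *\<^sub>R parab t"
    using assms by (auto simp: path_image_linepath closed_segment_def)
  have re: "Re z = s + u * (t - s)"
    using arg_cong[OF u(3), of Re] by (simp add: parab_def algebra_simps)
  have im: "Im z = (1 - u) * s\<^sup>2 + u * t\<^sup>2"
    using arg_cong[OF u(3), of Im] by (simp add: parab_def)
  show "s \<le> Re z" using re u assms by simp
  have "u * (t - s) \<le> 1 * (t - s)" using u assms by (intro mult_right_mono) auto
  then show "Re z \<le> t" using re by simp
  show "Im z = (s + t) * Re z - s * t"
    unfolding re im by (simp add: power2_eq_square algebra_simps)
qed

text \<open>The height of a chord above the parabola factors. A common point of two chords thus
  becomes an equality of two products at one abscissa, and height zero characterises the ends of a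
  chord.\<close>

lemma parab_segment_above:
  assumes "z \<in> path_image (linepath (parab s) (parab t))" "s < t"
  shows "Im z - (Re z)\<^sup>2 = (Re z - s) * (t - Re z)" "(Re z)\<^sup>2 \<le> Im z"
proof -
  note p = parab_segment[OF assms]
  show 1: "Im z - (Re z)\<^sup>2 = (Re z - s) * (t - Re z)"
    unfolding p(3) by (simp add: power2_eq_square algebra_simps)
  have "0 \<le> (Re z - s) * (t - Re z)" using p by simp
  then show "(Re z)\<^sup>2 \<le> Im z" using 1 by simp
qed

text \<open>Here \<open>x\<close> is the abscissa of a common point of the chords over
  \<open>[a, b]\<close> and \<open>[c, d]\<close>. With a common left end the equation factors.
  Intervals that do not overlap can share only an end. For nested intervals the inner chord is
  strictly lower to the left of \<open>d\<close>, so the chords can meet only at a common right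
  end.\<close>

lemma noncrossing_chords:
  fixes a b c d x :: real
  assumes "a < b" "c < d" "a \<le> c" "a \<le> x" "x \<le> b" "c \<le> x" "x \<le> d"
    "(x - a) * (b - x) = (x - c) * (d - x)" "\<not> (a < c \<and> c < b \<and> b < d)" "a \<noteq> c \<or> b \<noteq> d"
  shows "x = a \<and> a = c \<or> x = b \<and> (b = c \<or> b = d)"
proof (cases "a = c")
  case True
  then have "(x - a) * (b - d) = 0" using assms(8) by (simp add: algebra_simps)
  then show ?thesis using True assms(10) by simp
next
  case False
  then consider "b \<le> c" | "d \<le> b" "a < c" using assms by linarith
  then show ?thesis
  proof cases
    case 1
    then show ?thesis using assms by linarith
  next
    case 2
    have "d \<le> x"
    proof (rule ccontr)
      assume "\<not> d \<le> x"
      then have "(x - c) * (d - x) < (x - a) * (d - x)" using 2 by (intro mult_strict_right_mono) auto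
      also have "\<dots> \<le> (x - a) * (b - x)" using 2 assms by (intro mult_left_mono) auto
      finally show False using assms(8) by simp
    qed
    then have "x = d" using assms by simp
    then have "(x - a) * (b - x) = 0" using assms(8) by simp
    then show ?thesis using 2 \<open>x = d\<close> assms by auto
  qed
qed

text \<open>The vertical ray downwards from a point below the parabola misses \<open>D\<close> and
  is unbounded, so such points lie in \<open>outside D\<close>, and they accumulate at every point
  of the parabola.\<close>

lemma parab_on_frontier:
  assumes D: "\<And>z. z \<in> D \<Longrightarrow> (Re z)\<^sup>2 \<le> Im z" and t: "parab t \<in> D"
  shows "parab t \<in> frontier (outside D)"
proof -
  have out: "z \<in> outside D" if z: "Im z < (Re z)\<^sup>2" for z
  proof -
    let ?r = "{w. Re w = Re z \<and> Im w \<le> Im z}"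
    have "?r = {w. Re w = Re z} \<inter> {w. Im w \<le> Im z}" by auto
    then have "convex ?r"
      using convex_Int[OF convex_hyperplane[of "1::complex" "Re z"] convex_halfspace_le[of \<i> "Im z"]]
      by (simp add: inner_complex_def)
    then have "connected ?r" by (rule convex_connected)
    moreover have "?r \<subseteq> - D" using D z by fastforce
    ultimately have sub: "?r \<subseteq> connected_component_set (- D) z"
      by (intro connected_component_maximal) auto
    have "\<not> bounded ?r"
    proof
      assume "bounded ?r"
      then obtain B where B: "\<And>w. w \<in> ?r \<Longrightarrow> norm w \<le> B" by (auto simp: bounded_iff)
      let ?w = "Complex (Re z) (min (Im z) (- B - 1))"
      have "norm ?w \<le> B" by (rule B) simp
      moreover have "B + 1 \<le> \<bar>Im ?w\<bar>" by simp
      moreover have "\<bar>Im ?w\<bar> \<le> norm ?w" by (rule abs_Im_le_cmod)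
      ultimately show False by linarith
    qed
    then have "\<not> bounded (connected_component_set (- D) z)" using sub bounded_subset by blast
    then show ?thesis by (simp add: outside)
  qed
  have "parab t \<in> closure (outside D)"
    unfolding closure_approachable
  proof (intro allI impI)
    fix e :: real assume e: "0 < e"
    have "Complex t (t\<^sup>2 - e / 2) \<in> outside D" using e by (intro out) simp
    moreover have "Complex t (t\<^sup>2 - e / 2) - parab t = Complex 0 (- e / 2)"
      by (simp add: parab_def complex_eq_iff)
    then have "dist (Complex t (t\<^sup>2 - e / 2)) (parab t) < e"
      using e by (simp add: dist_norm complex_norm)
    ultimately show "\<exists>y\<in>outside D. dist y (parab t) < e" by blast
  qed
  moreover have "parab t \<notin> interior (outside D)"
    using t interior_subset outside_no_overlap[of D] by blast
  ultimately show ?thesis by (simp add: frontier_def)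
qed

text \<open>An edge is an unordered pair; \<open>Min\<close> and \<open>Max\<close> make its
  parametrisation unambiguous, running from left to right.\<close>

definition parab_drawing :: "('a \<Rightarrow> real) \<Rightarrow> 'a set \<Rightarrow> real \<Rightarrow> complex" where
  "parab_drawing f e = linepath (parab (Min (f ` e))) (parab (Max (f ` e)))"

lemma parab_drawing_edge: "f x < f y \<Longrightarrow> parab_drawing f {x, y} = linepath (parab (f x)) (parab (f y))"
  by (simp add: parab_drawing_def min_def max_def)

lemma outerplanar_if_noncrossing:
  fixes f :: "'a \<Rightarrow> real"
  assumes edges: "\<And>e. e \<in> edges G \<Longrightarrow> \<exists>u\<in>verts G. \<exists>v\<in>verts G. u \<noteq> v \<and> e = {u, v}"
    and inj: "inj_on f (verts G)"
    and nc: "\<And>a b c d. a \<in> verts G \<Longrightarrow> b \<in> verts G \<Longrightarrow> c \<in> verts G \<Longrightarrow> d \<in> verts G \<Longrightarrow>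
      f a < f b \<Longrightarrow> f b < f c \<Longrightarrow> f c < f d \<Longrightarrow> {a, c} \<in> edges G \<Longrightarrow> {b, d} \<in> edges G \<Longrightarrow> False"
  shows "outerplanar G"
proof -
  define p where "p v = parab (f v)" for v
  let ?g = "parab_drawing f"
  have ed: "\<exists>x y. x \<in> verts G \<and> y \<in> verts G \<and> f x < f y \<and> e = {x, y}" if "e \<in> edges G" for e
  proof -
    obtain u v where uv: "u \<in> verts G" "v \<in> verts G" "u \<noteq> v" "e = {u, v}" using edges \<open>e \<in> edges G\<close> by blast
    then have "f u \<noteq> f v" using inj by (auto simp: inj_on_def)
    then consider "f u < f v" | "f v < f u" by linarith
    then show ?thesis using uv by cases (auto simp: insert_commute)
  qed
  have injp: "inj_on p (verts G)" using inj by (auto simp: p_def inj_on_def inj_parab)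
  have e1: "arc (?g e) \<and> {pathstart (?g e), pathfinish (?g e)} = p ` e \<and> path_image (?g e) \<inter> p ` verts G = p ` e"
    if e: "e \<in> edges G" for e
  proof -
    obtain x y where xy: "x \<in> verts G" "y \<in> verts G" "f x < f y" "e = {x, y}" using ed[OF e] by blast
    have g: "?g e = linepath (parab (f x)) (parab (f y))" using xy by (simp add: parab_drawing_edge)
    have "arc (?g e)" unfolding g using xy by (intro arc_linepath) (simp add: inj_parab)
    moreover have "{pathstart (?g e), pathfinish (?g e)} = p ` e" unfolding g using xy by (auto simp: p_def)
    moreover have "v \<in> e" if v: "v \<in> verts G" "p v \<in> path_image (?g e)" for v
    proof -
      \<comment> \<open>A vertex lies on the parabola, so its height is zero and one of the two
        factors vanishes.\<close>
      have "(Re (p v) - f x) * (f y - Re (p v)) = 0"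
        using parab_segment_above(1)[of "p v" "f x" "f y"] v g xy by (simp add: p_def parab_def)
      then have "f v = f x \<or> f v = f y" by (auto simp: p_def parab_def)
      then show ?thesis using inj v xy by (auto simp: inj_on_def)
    qed
    moreover have "p ` e \<subseteq> path_image (?g e)" unfolding g using xy by (auto simp: p_def)
    moreover have "e \<subseteq> verts G" using xy by auto
    ultimately show ?thesis by blast
  qed
  \<comment> \<open>The chord that starts further to the left comes first, as
    \<open>noncrossing_chords\<close> demands; the other case follows by exchanging the two
    edges.\<close>
  have e2: "z \<in> p ` (e \<inter> e')"
    if e: "e \<in> edges G" "e' \<in> edges G" "e \<noteq> e'" and z: "z \<in> path_image (?g e)" "z \<in> path_image (?g e')"
      and ab: "a \<in> verts G" "b \<in> verts G" "f a < f b" "e = {a, b}"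
      and cd: "c \<in> verts G" "d \<in> verts G" "f c < f d" "e' = {c, d}" and le: "f a \<le> f c" for e e' z a b c d
  proof -
    have z1: "z \<in> path_image (linepath (parab (f a)) (parab (f b)))" using z ab by (simp add: parab_drawing_edge)
    have z2: "z \<in> path_image (linepath (parab (f c)) (parab (f d)))" using z cd by (simp add: parab_drawing_edge)
    note s1 = parab_segment[OF z1 ab(3)] parab_segment_above(1)[OF z1 ab(3)]
    note s2 = parab_segment[OF z2 cd(3)] parab_segment_above(1)[OF z2 cd(3)]
    have n: "\<not> (f a < f c \<and> f c < f b \<and> f b < f d)" using nc[of a c b d] ab cd e by auto
    have ne: "f a \<noteq> f c \<or> f b \<noteq> f d" using e(3) ab cd inj by (auto simp: inj_on_def)
    have x: "Re z = f a \<and> f a = f c \<or> Re z = f b \<and> (f b = f c \<or> f b = f d)"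
      using noncrossing_chords[OF ab(3) cd(3) le s1(1,2) s2(1,2) _ n ne] s1(4) s2(4) by simp
    \<comment> \<open>At an end of a chord the height is zero, so \<open>z\<close> is a point of the
      parabola and thus the image of a vertex.\<close>
    then have "Im z - (Re z)\<^sup>2 = 0" using s1(4) by auto
    then have "z = parab (Re z)" by (simp add: parab_def complex_eq_iff)
    moreover have "a = c \<or> b = c \<or> b = d" "f a = f c \<Longrightarrow> a = c" "f b = f c \<Longrightarrow> b = c" "f b = f d \<Longrightarrow> b = d"
      using x inj ab cd by (auto simp: inj_on_def)
    ultimately have "z = p a \<and> a = c \<or> z = p b \<and> (b = c \<or> b = d)" using x by (auto simp: p_def)
    then show ?thesis using ab cd by auto
  qed
  have e3: "path_image (?g e) \<inter> path_image (?g e') \<subseteq> p ` (e \<inter> e')"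
    if e: "e \<in> edges G" "e' \<in> edges G" "e \<noteq> e'" for e e'
  proof
    fix z assume z: "z \<in> path_image (?g e) \<inter> path_image (?g e')"
    obtain a b where ab: "a \<in> verts G" "b \<in> verts G" "f a < f b" "e = {a, b}" using ed[OF e(1)] by blast
    obtain c d where cd: "c \<in> verts G" "d \<in> verts G" "f c < f d" "e' = {c, d}" using ed[OF e(2)] by blast
    show "z \<in> p ` (e \<inter> e')"
    proof (cases "f a \<le> f c")
      case True
      then show ?thesis using e2[OF e _ _ ab cd] z by blast
    next
      case False
      then have "z \<in> p ` (e' \<inter> e)" using e2[OF e(2,1) e(3)[symmetric] _ _ cd ab] z by auto
      then show ?thesis by (simp add: Int_commute)
    qed
  qed
  have emb: "plane_embedding G p ?g"
    unfolding plane_embedding_def using injp e1 e3 by blast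
  have above: "(Re z)\<^sup>2 \<le> Im z" if z: "z \<in> drawing G p ?g" for z
  proof -
    consider v where "z = p v" | e where "e \<in> edges G" "z \<in> path_image (?g e)"
      using z unfolding drawing_def by blast
    then show ?thesis
    proof cases
      case 1 then show ?thesis by (simp add: p_def parab_def)
    next
      case 2
      obtain x y where "f x < f y" "e = {x, y}" using ed[OF 2(1)] by blast
      then show ?thesis using parab_segment_above(2)[of z "f x" "f y"] 2(2) by (simp add: parab_drawing_edge)
    qed
  qed
  have "p v \<in> frontier (outside (drawing G p ?g))" if "v \<in> verts G" for v
    using parab_on_frontier[of "drawing G p ?g" "f v"] above that by (auto simp: p_def drawing_def)
  then show ?thesis using emb unfolding outerplanar_def by blast
qed

section \<open>Outerplanar embeddings\<close>

locale plane_drawing =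
  fixes G :: "'a ugraph" and p :: "'a \<Rightarrow> complex" and \<gamma> :: "'a set \<Rightarrow> real \<Rightarrow> complex"
  assumes G: "simple_graph G" and emb: "plane_embedding G p \<gamma>"
begin

abbreviation "im e \<equiv> path_image (\<gamma> e)"

definition part :: "'a set \<Rightarrow> complex set" where
  "part K = p ` K \<union> (\<Union>e\<in>{e \<in> edges G. e \<subseteq> K}. im e)"

text \<open>The condition \<open>e \<inter> K \<noteq> {}\<close> excludes a possible edge
  \<open>{a, b}\<close>, which would otherwise be shared by the stars of different branch
  sets.\<close>

definition star :: "'a \<Rightarrow> 'a \<Rightarrow> 'a set \<Rightarrow> complex set" where
  "star a b K = p ` K \<union> (\<Union>e\<in>{e \<in> edges G. e \<subseteq> K \<union> {a, b} \<and> e \<inter> K \<noteq> {}}. im e)"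

lemma inj: "inj_on p (verts G)"
  using emb by (simp add: plane_embedding_def)

lemma edge:
  assumes "e \<in> edges G"
  shows "arc (\<gamma> e)" "{pathstart (\<gamma> e), pathfinish (\<gamma> e)} = p ` e" "im e \<inter> p ` verts G = p ` e" "e \<subseteq> verts G"
proof -
  show "arc (\<gamma> e)" "{pathstart (\<gamma> e), pathfinish (\<gamma> e)} = p ` e" "im e \<inter> p ` verts G = p ` e"
    using emb assms by (simp_all add: plane_embedding_def)
  show "e \<subseteq> verts G" using simple_graph_edgeE[OF G assms] by blast
qed

lemma edges_meet: "e \<in> edges G \<Longrightarrow> e' \<in> edges G \<Longrightarrow> e \<noteq> e' \<Longrightarrow> im e \<inter> im e' \<subseteq> p ` (e \<inter> e')"
  using emb unfolding plane_embedding_def by blast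

lemma vertex_on_edge: "e \<in> edges G \<Longrightarrow> v \<in> verts G \<Longrightarrow> p v \<in> im e \<longleftrightarrow> v \<in> e"
  using edge(3,4)[of e] inj by (auto simp: inj_on_def)

lemma edge_path_connected: "e \<in> edges G \<Longrightarrow> path_connected (im e)"
  using edge(1) arc_imp_path path_connected_path_image by blast

lemma edge_closed: "e \<in> edges G \<Longrightarrow> closed (im e)"
  using edge(1) closed_arc_image by blast

lemma path_connected_part:
  assumes "conn (edges G) K" "K \<subseteq> verts G"
  shows "path_connected (part K)"
proof -
  have e: "path_component (part K) z w" if "e \<in> edges G" "e \<subseteq> K" "z \<in> im e" "w \<in> im e" for e z w
  proof -
    have "im e \<subseteq> part K" using that by (auto simp: part_def)
    moreover have "path_component (im e) z w"
      using edge_path_connected[OF that(1)] that by (simp add: path_connected_component)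
    ultimately show ?thesis using path_component_of_subset by blast
  qed
  have v: "path_component (part K) (p s) (p t)" if "s \<in> K" "t \<in> K" for s t
  proof -
    have "(s, t) \<in> (adj_on (edges G) K)\<^sup>*" using assms(1) that by (simp add: conn_def)
    then show ?thesis
    proof (induction rule: rtrancl_induct)
      case base
      then show ?case using that by (intro path_component_refl) (auto simp: part_def)
    next
      case (step y z)
      then have yz: "y \<in> K" "z \<in> K" "{y, z} \<in> edges G" by (auto simp: adj_on_def)
      then have "p y \<in> im {y, z}" "p z \<in> im {y, z}"
        using vertex_on_edge[OF yz(3)] assms(2) by auto
      then have "path_component (part K) (p y) (p z)" using e[OF yz(3)] yz by auto
      then show ?case using step.IH path_component_trans by blast
    qed
  qed
  have near: "\<exists>s\<in>K. path_component (part K) z (p s)" if z: "z \<in> part K" for z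
  proof -
    consider s where "s \<in> K" "z = p s" | e where "e \<in> edges G" "e \<subseteq> K" "z \<in> im e"
      using z unfolding part_def by blast
    then show ?thesis
    proof cases
      case 1
      then show ?thesis using v by auto
    next
      case 2
      then obtain x y where xy: "e = {x, y}" "x \<in> verts G" using simple_graph_edgeE[OF G, of e] by metis
      then have "p x \<in> im e" using vertex_on_edge[OF 2(1)] by auto
      then show ?thesis using e[OF 2] xy 2 by auto
    qed
  qed
  show ?thesis
    unfolding path_connected_component
  proof (intro ballI)
    fix z w assume "z \<in> part K" "w \<in> part K"
    then obtain s t where "s \<in> K" "path_component (part K) z (p s)" "t \<in> K" "path_component (part K) w (p t)"
      using near by metis
    then show "path_component (part K) z w"
      using v path_component_trans path_component_sym by metis
  qed
qed

text \<open>Drawn edges meet only in common ends, and a vertex lies only on its own edges. An edge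
  of one star and an edge of the other have no common end besides \<open>a\<close> and
  \<open>b\<close>.\<close>

lemma star_Int:
  assumes "K \<subseteq> verts G" "L \<subseteq> verts G" "a \<in> verts G" "b \<in> verts G"
    and d: "K \<inter> L = {}" "a \<notin> K" "b \<notin> K" "a \<notin> L" "b \<notin> L"
  shows "star a b K \<inter> star a b L \<subseteq> {p a, p b}"
proof
  fix z assume z: "z \<in> star a b K \<inter> star a b L"
  have vv: "z \<noteq> p t" if "z = p s" "s \<in> K" "t \<in> L" for s t
  proof
    assume "z = p t"
    then have "s = t" using inj_onD[OF inj, of s t] that assms(1,2) by auto
    then show False using that d(1) by blast
  qed
  have vK: False if "s \<in> K" "z = p s" "e \<in> edges G" "e \<subseteq> L \<union> {a, b}" "z \<in> im e" for s e
  proof -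
    have "s \<in> e" using vertex_on_edge[OF that(3), of s] that assms(1) by auto
    then show False using that d by blast
  qed
  have vL: False if "s \<in> L" "z = p s" "e \<in> edges G" "e \<subseteq> K \<union> {a, b}" "z \<in> im e" for s e
  proof -
    have "s \<in> e" using vertex_on_edge[OF that(3), of s] that assms(2) by auto
    then show False using that d by blast
  qed
  have ee: "z \<in> {p a, p b}" if e: "e \<in> edges G" "e \<subseteq> K \<union> {a, b}" "e \<inter> K \<noteq> {}" "z \<in> im e"
    and f: "f \<in> edges G" "f \<subseteq> L \<union> {a, b}" "f \<inter> L \<noteq> {}" "z \<in> im f" for e f
  proof -
    have "e \<noteq> f" using e f d by blast
    then have "z \<in> p ` (e \<inter> f)" using edges_meet[OF e(1) f(1)] e f by blast
    moreover have "e \<inter> f \<subseteq> {a, b}" using e f d by blast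
    ultimately show ?thesis by blast
  qed
  consider s where "s \<in> K" "z = p s"
    | e where "e \<in> edges G" "e \<subseteq> K \<union> {a, b}" "e \<inter> K \<noteq> {}" "z \<in> im e"
    using z unfolding star_def by blast
  note z1 = this
  consider s where "s \<in> L" "z = p s"
    | e where "e \<in> edges G" "e \<subseteq> L \<union> {a, b}" "e \<inter> L \<noteq> {}" "z \<in> im e"
    using z unfolding star_def by blast
  note z2 = this
  show "z \<in> {p a, p b}"
    by (rule z1; rule z2) (use vv vK vL ee in metis)+
qed

lemma part_subset_star: "part K \<subseteq> star a b K"
proof -
  have "e \<inter> K \<noteq> {}" if e: "e \<in> edges G" "e \<subseteq> K" for e
  proof -
    obtain x y where "e = {x, y}" using simple_graph_edgeE[OF G e(1)] .
    then show ?thesis using e(2) by auto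
  qed
  then have "{e \<in> edges G. e \<subseteq> K} \<subseteq> {e \<in> edges G. e \<subseteq> K \<union> {a, b} \<and> e \<inter> K \<noteq> {}}" by blast
  then show ?thesis unfolding part_def star_def by (intro Un_mono UN_mono order_refl)
qed

text \<open>Arcwise connectedness of the drawn set spares the concatenation of edge arcs. The
  contact with \<open>part K\<close> serves later: when the arc lies inside a closed curve, it
  exhibits a point of \<open>part K\<close> there.\<close>

lemma arc_through_part:
  assumes K: "conn (edges G) K" "K \<subseteq> verts G" "a \<notin> K" "b \<notin> K" "a \<noteq> b" "a \<in> verts G" "b \<in> verts G"
    and t: "touch (edges G) {a} K" "touch (edges G) {b} K"
  obtains c where "arc c" "pathstart c = p a" "pathfinish c = p b" "path_image c \<subseteq> star a b K"
    "path_image c \<inter> part K \<noteq> {}"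
proof -
  obtain x y where x: "x \<in> K" "{a, x} \<in> edges G" and y: "y \<in> K" "{b, y} \<in> edges G"
    using t by (auto simp: touch_def)
  let ?A = "im {a, x}" and ?B = "im {b, y}"
  have A: "p a \<in> ?A" "p x \<in> ?A" and B: "p b \<in> ?B" "p y \<in> ?B"
    using vertex_on_edge[OF x(2)] vertex_on_edge[OF y(2)] x y K by auto
  have xy: "p x \<in> part K" "p y \<in> part K" using x y by (auto simp: part_def)
  have "path_connected (part K \<union> ?A)"
    using A xy by (intro path_connected_Un path_connected_part[OF K(1,2)] edge_path_connected[OF x(2)]) auto
  then have "path_connected ((part K \<union> ?A) \<union> ?B)"
    by (rule path_connected_Un[OF _ edge_path_connected[OF y(2)]]) (use B xy in auto)
  moreover have "p a \<noteq> p b" using inj K by (auto simp: inj_on_def)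
  moreover have "p a \<in> (part K \<union> ?A) \<union> ?B" "p b \<in> (part K \<union> ?A) \<union> ?B" using A B by auto
  ultimately have "\<exists>c. arc c \<and> path_image c \<subseteq> (part K \<union> ?A) \<union> ?B \<and> pathstart c = p a \<and> pathfinish c = p b"
    unfolding path_connected_arcwise by blast
  then obtain c where c: "arc c" "pathstart c = p a" "pathfinish c = p b"
    "path_image c \<subseteq> (part K \<union> ?A) \<union> ?B" by blast
  have "?A \<subseteq> star a b K" unfolding star_def by (intro subsetI UnI2 UN_I[of "{a, x}"]) (use x in auto)
  moreover have "?B \<subseteq> star a b K" unfolding star_def by (intro subsetI UnI2 UN_I[of "{b, y}"]) (use y in auto)
  ultimately have "(part K \<union> ?A) \<union> ?B \<subseteq> star a b K" using part_subset_star by blast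
  moreover have "path_image c \<inter> part K \<noteq> {}"
  proof
    \<comment> \<open>The two end edges meet only in \<open>part K\<close>. An arc avoiding
      \<open>part K\<close> would be covered by two closed sets that are disjoint on it and contain
      one of its ends each, contradicting connectedness.\<close>
    assume dis: "path_image c \<inter> part K = {}"
    have "?A \<inter> ?B \<subseteq> p ` ({a, x} \<inter> {b, y})"
      using x y K by (intro edges_meet) (auto simp: doubleton_eq_iff)
    also have "\<dots> \<subseteq> part K" using x y K xy by auto
    finally have "?A \<inter> ?B \<inter> path_image c = {}" using dis by blast
    moreover have "connected (path_image c)" using c(1) by (simp add: connected_arc_image)
    moreover have "path_image c \<subseteq> ?A \<union> ?B" using c(4) dis by blast
    ultimately have "?A \<inter> path_image c = {} \<or> ?B \<inter> path_image c = {}"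
      using connected_closedD[of "path_image c" ?A ?B] edge_closed[OF x(2)] edge_closed[OF y(2)] by simp
    moreover have "p a \<in> path_image c" "p b \<in> path_image c"
      using pathstart_in_path_image[of c] pathfinish_in_path_image[of c] c(2,3) by simp_all
    ultimately show False using A B by blast
  qed
  ultimately show ?thesis using that[OF c(1-3) order_trans[OF c(4)]] by blast
qed

text \<open>The connected set \<open>part K\<close> lies wholly inside \<open>C\<close>, and so does
  one of its vertices. The inside is open, so it would contain points of the outer face of the
  drawing, which is contained in \<open>outside C\<close>.\<close>

lemma part_inside_False:
  assumes fr: "p ` verts G \<subseteq> frontier (outside (drawing G p \<gamma>))"
    and K: "conn (edges G) K" "K \<subseteq> verts G" "K \<noteq> {}"
    and C: "closed C" "C \<subseteq> drawing G p \<gamma>" "part K \<inter> C = {}" "part K \<inter> inside C \<noteq> {}"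
  shows False
proof -
  have "part K \<subseteq> inside C"
    using path_connected_imp_connected[OF path_connected_part[OF K(1,2)]] C
    by (intro connected_subset_inside)
  then obtain x where x: "x \<in> K" "p x \<in> inside C" using K(3) by (auto simp: part_def)
  have "p x \<in> closure (outside (drawing G p \<gamma>))"
    using fr x K by (auto simp: frontier_def)
  then have "inside C \<inter> outside (drawing G p \<gamma>) \<noteq> {}"
    using x open_inside[OF C(1)] open_Int_closure_eq_empty[of "inside C"] by blast
  then show False using outside_mono[OF C(2)] inside_Int_outside[of C] by blast
qed

lemma star_subset_drawing: "K \<subseteq> verts G \<Longrightarrow> star a b K \<subseteq> drawing G p \<gamma>"
  unfolding star_def drawing_def by auto

lemma vertex_notin_part:
  assumes "K \<subseteq> verts G" "v \<in> verts G" "v \<notin> K"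
  shows "p v \<notin> part K"
proof
  assume "p v \<in> part K"
  then consider s where "s \<in> K" "p v = p s" | e where "e \<in> edges G" "e \<subseteq> K" "p v \<in> im e"
    unfolding part_def by blast
  then show False
  proof cases
    case 1
    then have "v = s" using inj_onD[OF inj, of v s] assms by auto
    then show False using 1 assms by simp
  next
    case 2
    then show False using vertex_on_edge[OF 2(1) assms(2)] assms(3) by blast
  qed
qed

lemma part_subset_star_interior:
  assumes "K \<subseteq> verts G" "a \<notin> K" "b \<notin> K" "a \<in> verts G" "b \<in> verts G"
  shows "part K \<subseteq> star a b K - {p a, p b}"
  using part_subset_star[of K a b] vertex_notin_part[of K a] vertex_notin_part[of K b] assms by blast

text \<open>By \<open>theta_curve\<close> one of the arcs through the three branch sets lies, up to
  its ends, inside the curve of the other two. That arc meets the drawn part of its branch set,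
  which therefore cannot have its vertices on the outer face.\<close>

lemma frontier_imp_no_K23:
  assumes fr: "p ` verts G \<subseteq> frontier (outside (drawing G p \<gamma>))"
  shows "\<not> has_K23 (edges G)"
proof
  let ?E = "edges G"
  assume "has_K23 ?E"
  then obtain A B K L M where m: "K23_model ?E A B K L M" by (auto simp: has_K23_def)
  have V: "\<Union>?E \<subseteq> verts G" using edge(4) by blast
  have "finite (verts G)" using G by (simp add: simple_graph_def)
  moreover have "A \<subseteq> verts G" "B \<subseteq> verts G" using K23_model_covered[OF m] V by blast+
  ultimately have "finite A" "finite B" using finite_subset by auto
  then obtain a b K L M where m: "K23_model ?E {a} {b} K L M" using K23_model_shrink[OF m] by blast
  have c: "conn ?E K" "conn ?E L" "conn ?E M"
    and t: "touch ?E {a} K" "touch ?E {b} K" "touch ?E {a} L" "touch ?E {b} L" "touch ?E {a} M" "touch ?E {b} M"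
    and d: "a \<noteq> b" "a \<notin> K" "a \<notin> L" "a \<notin> M" "b \<notin> K" "b \<notin> L" "b \<notin> M" "K \<inter> L = {}" "K \<inter> M = {}" "L \<inter> M = {}"
    and ne: "K \<noteq> {}" "L \<noteq> {}" "M \<noteq> {}"
    using m by (auto simp: K23_model_def branch_sets_def)
  have v: "a \<in> verts G" "b \<in> verts G" "K \<subseteq> verts G" "L \<subseteq> verts G" "M \<subseteq> verts G"
    using K23_model_covered[OF m] V by blast+
  obtain g where g: "arc g" "pathstart g = p a" "pathfinish g = p b" "path_image g \<subseteq> star a b K"
    "path_image g \<inter> part K \<noteq> {}"
    using arc_through_part[OF c(1) v(3) d(2,5,1) v(1,2) t(1,2)] .
  obtain h where h: "arc h" "pathstart h = p a" "pathfinish h = p b" "path_image h \<subseteq> star a b L"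
    "path_image h \<inter> part L \<noteq> {}"
    using arc_through_part[OF c(2) v(4) d(3,6,1) v(1,2) t(3,4)] .
  obtain k where k: "arc k" "pathstart k = p a" "pathfinish k = p b" "path_image k \<subseteq> star a b M"
    "path_image k \<inter> part M \<noteq> {}"
    using arc_through_part[OF c(3) v(5) d(4,7,1) v(1,2) t(5,6)] .
  have s: "star a b K \<inter> star a b L \<subseteq> {p a, p b}" "star a b L \<inter> star a b M \<subseteq> {p a, p b}"
    "star a b K \<inter> star a b M \<subseteq> {p a, p b}"
    using v d by (intro star_Int; simp)+
  note sub = part_subset_star_interior[OF v(3) d(2,5) v(1,2)] part_subset_star_interior[OF v(4) d(3,6) v(1,2)]
    part_subset_star_interior[OF v(5) d(4,7) v(1,2)]
  note dr = star_subset_drawing[OF v(3), of a b] star_subset_drawing[OF v(4), of a b]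
    star_subset_drawing[OF v(5), of a b]
  note cl = closed_arc_image[OF g(1)] closed_arc_image[OF h(1)] closed_arc_image[OF k(1)]
  have "path_image g \<inter> path_image h \<subseteq> {p a, p b}" "path_image h \<inter> path_image k \<subseteq> {p a, p b}"
    "path_image g \<inter> path_image k \<subseteq> {p a, p b}"
    using s g(4) h(4) k(4) by blast+
  from theta_curve[OF g(1) h(1) k(1) g(2,3) h(2,3) k(2,3) this] show False
  proof (elim disjE)
    assume i: "path_image g - {p a, p b} \<subseteq> inside (path_image h \<union> path_image k)"
    show False
    proof (rule part_inside_False[OF fr c(1) v(3) ne(1) closed_Un[OF cl(2,3)]])
      show "path_image h \<union> path_image k \<subseteq> drawing G p \<gamma>" using h(4) k(4) dr by blast
      show "part K \<inter> (path_image h \<union> path_image k) = {}" using sub(1) s h(4) k(4) by blast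
      show "part K \<inter> inside (path_image h \<union> path_image k) \<noteq> {}" using i g(5) sub(1) by blast
    qed
  next
    assume i: "path_image h - {p a, p b} \<subseteq> inside (path_image g \<union> path_image k)"
    show False
    proof (rule part_inside_False[OF fr c(2) v(4) ne(2) closed_Un[OF cl(1,3)]])
      show "path_image g \<union> path_image k \<subseteq> drawing G p \<gamma>" using g(4) k(4) dr by blast
      show "part L \<inter> (path_image g \<union> path_image k) = {}" using sub(2) s g(4) k(4) by blast
      show "part L \<inter> inside (path_image g \<union> path_image k) \<noteq> {}" using i h(5) sub(2) by blast
    qed
  next
    assume i: "path_image k - {p a, p b} \<subseteq> inside (path_image g \<union> path_image h)"
    show False
    proof (rule part_inside_False[OF fr c(3) v(5) ne(3) closed_Un[OF cl(1,2)]])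
      show "path_image g \<union> path_image h \<subseteq> drawing G p \<gamma>" using g(4) h(4) dr by blast
      show "part M \<inter> (path_image g \<union> path_image h) = {}" using sub(3) s g(4) h(4) by blast
      show "part M \<inter> inside (path_image g \<union> path_image h) \<noteq> {}" using i k(5) sub(3) by blast
    qed
  qed
qed

end

lemma outerplanar_imp_no_K23:
  assumes "simple_graph G" "outerplanar G"
  shows "\<not> has_K23 (edges G)"
proof -
  obtain p \<gamma> where "plane_embedding G p \<gamma>" "p ` verts G \<subseteq> frontier (outside (drawing G p \<gamma>))"
    using assms(2) by (auto simp: outerplanar_def)
  then show ?thesis
    using assms(1) plane_drawing.frontier_imp_no_K23 plane_drawing.intro by blast
qed

lemma no_K23_imp_outerplanar:
  assumes "simple_graph G" "bipartite G" "\<not> has_K23 (edges G)"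
  shows "outerplanar G"
proof -
  obtain X Y where bip: "bipartition G X Y" using assms(2) by (auto simp: bipartite_def)
  have "finite (verts G)" using assms(1) by (simp add: simple_graph_def)
  then obtain xs where xs: "ordering (edges G) (verts G) xs"
    using ex_ordering[OF assms(3) bipartition_edge[OF bip]] by blast
  \<comment> \<open>The position of a vertex in the ordering serves as its abscissa on the
    parabola.\<close>
  define ix where "ix = inv_into {..<length xs} ((!) xs)"
  have bij: "bij_betw ((!) xs) {..<length xs} (verts G)"
    using xs by (intro bij_betw_nth) (auto simp: ordering_def)
  have ix: "ix v < length xs" "xs ! ix v = v" if "v \<in> verts G" for v
    using that bij_betw_inv_into_right[OF bij that] bij_betwE[OF bij_betw_inv_into[OF bij]]
    by (auto simp: ix_def)
  have inj: "inj_on ix (verts G)" using ix(2) by (metis inj_onI)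
  show ?thesis
  proof (rule outerplanar_if_noncrossing[where f = "\<lambda>v. real (ix v)"])
    show "\<exists>u\<in>verts G. \<exists>v\<in>verts G. u \<noteq> v \<and> e = {u, v}" if "e \<in> edges G" for e
      using assms(1) that by (simp add: simple_graph_def)
    show "inj_on (\<lambda>v. real (ix v)) (verts G)" using inj by (simp add: inj_on_def)
    fix a b c d
    assume v: "a \<in> verts G" "b \<in> verts G" "c \<in> verts G" "d \<in> verts G"
      and lt: "real (ix a) < real (ix b)" "real (ix b) < real (ix c)" "real (ix c) < real (ix d)"
      and e: "{a, c} \<in> edges G" "{b, d} \<in> edges G"
    have "noncrossing (edges G) xs" using xs by (simp add: ordering_def)
    then show False
      using noncrossingD[of "edges G" xs "ix a" "ix b" "ix c" "ix d"] lt e ix v by simp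
  qed
qed

theorem theorem2p4:
  fixes G :: "'a ugraph"
  assumes "simple_graph G" and "bipartite G"
  shows "outerplanar G \<longleftrightarrow> \<not> bipartite_minor (complete_bipartite 2 3) G"
  using outerplanar_imp_no_K23 no_K23_imp_outerplanar has_K23_imp_bipartite_minor
    bipartite_minor_K23_imp_has_K23 assms by blast

end
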